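(* Let $M\subset(N^3,g)$ be a $G_X$-invariant surface of constant negative Gauss curvature $K=-1/R^2$, locally parametrized by $\psi(u,v)=\phi_v(\gamma(u))$ with $\gamma$ a horizontal lift of the profile curve. Let $\omega(u)=\|X(\gamma(u))\|_g$ and let $a\in\mathbb{R}$ be the constant value of $\omega(u)^2-R^2\omega_u(u)^2$. Then a loxodrome on $M$ which is not an orbit can be parametrized by $\psi(u,v(u))$ with $$v(u)=\mp\frac{\cot\vartheta_0}{\omega_u(u)}+b\quad\text{if }a=0,$$ $$v(u)=\mp\frac{R\cot\vartheta_0}{\sqrt{-a}}\,\ln\left(\frac{R\,\omega_u(u)+\sqrt{-a}}{\omega(u)}\right)+b\quad\text{if }a<0,$$ $$v(u)=\pm\frac{R\cot\vartheta_0}{\sqrt a}\,\arcsin\left(\frac{R\,\omega_u(u)}{\omega(u)}\right)+b\quad\text{if }a>0,$$ where $b\in\mathbb{R}$ and $\vartheta_0$ is the constant angle between the loxodrome and $X$.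
   Context: $(N^3,g)$ is a three-dimensional Riemannian manifold, $X$ a Killing vector field on $N$, $G_X$ the one-parameter group of isometries generated by $X$, and $\phi_v$ the local flow of $X$. $N_r\subset N$ is the regular part (the set of points belonging to principal orbits of $G_X$). The quotient $N_r/G_X$ carries the quotient metric $\tilde g$ making $\pi:N_r\to N_r/G_X$ a Riemannian submersion. A $G_X$-invariant surface is the image in $N_r$ of an immersion $f:M\to N$ for which there is an action of $G_X$ on $M$ with $f(xp)=xf(p)$ for all $x\in G_X$, $p\in M$; $M$ carries the induced metric, and its Gauss curvature is that of this metric. Locally it is parametrized by $\psi(u,v)=\phi_v(\gamma(u))$, where $\tilde\gamma:I\to (N_r/G_X,\tilde g)$ ($I$ an open interval) is a curve parametrized by arc length (the profile curve) and $\gamma:I\to N$ is a lift of it. The lift is horizontal if $\gamma'$ is orthogonal to $X$; then the induced metric is $du^2+\omega(u)^2dv^2$. Subscripts $u$ denote derivatives. A loxodrome on $M$ is a curve on $M$ making a constant angle $\vartheta_0\in[0,\pi)$ with $X$: parametrized by arc length, $g(\alpha',X)=\omega\cos\vartheta_0$. A loxodrome that is not an orbit has $\vartheta_0\ne0$. *)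

theory Defs
  imports "HOL-Analysis.Analysis"
begin

section \<open>Smooth maps between normed spaces\<close>

text \<open>
  Both notions are meant for open sets only: derivatives are taken in the ambient space.
\<close>

primrec times_differentiable_on ::
  "nat \<Rightarrow> 'a::real_normed_vector set \<Rightarrow> ('a \<Rightarrow> 'b::real_normed_vector) \<Rightarrow> bool" where
  "times_differentiable_on 0 S f \<longleftrightarrow> continuous_on S f"
| "times_differentiable_on (Suc n) S f \<longleftrightarrow>
     (\<forall>x\<in>S. f differentiable (at x)) \<and>
     (\<forall>v. times_differentiable_on n S (\<lambda>x. frechet_derivative f (at x) v))"

definition smooth_on :: "'a::real_normed_vector set \<Rightarrow> ('a \<Rightarrow> 'b::real_normed_vector) \<Rightarrow> bool" where
  "smooth_on S f \<longleftrightarrow> (\<forall>n. times_differentiable_on n S f)"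

definition open_interval :: "real set \<Rightarrow> bool" where
  "open_interval I \<longleftrightarrow> I \<noteq> {} \<and> open I \<and> is_interval I"


section \<open>Smooth manifolds\<close>

text \<open>
  A chart is a pair of its domain and its coordinate map; the values of the coordinate map
  outside the domain carry no information.  The underlying space of a manifold is a whole
  Hausdorff second countable type, and the smooth structure is a maximal atlas.
\<close>

type_synonym ('a, 'e) chart = "'a set \<times> ('a \<Rightarrow> 'e)"

definition chart_inv :: "('a, 'e) chart \<Rightarrow> 'e \<Rightarrow> 'a" where
  "chart_inv c = inv_into (fst c) (snd c)"

definition is_chart :: "('a::topological_space, 'e::euclidean_space) chart \<Rightarrow> bool" where
  "is_chart c \<longleftrightarrow> open (fst c) \<and> open (snd c ` fst c) \<and>
     homeomorphism (fst c) (snd c ` fst c) (snd c) (chart_inv c)"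

definition compatible_charts ::
  "('a, 'e::euclidean_space) chart \<Rightarrow> ('a, 'e) chart \<Rightarrow> bool" where
  "compatible_charts c d \<longleftrightarrow>
     smooth_on (snd c ` (fst c \<inter> fst d)) (snd d \<circ> chart_inv c) \<and>
     smooth_on (snd d ` (fst c \<inter> fst d)) (snd c \<circ> chart_inv d)"

definition smooth_structure ::
  "('a::{t2_space, second_countable_topology}, 'e::euclidean_space) chart set \<Rightarrow> bool" where
  "smooth_structure A \<longleftrightarrow>
     (\<forall>c\<in>A. is_chart c) \<and> (\<Union>c\<in>A. fst c) = UNIV \<and>
     (\<forall>c\<in>A. \<forall>d\<in>A. compatible_charts c d) \<and>
     (\<forall>c. is_chart c \<and> (\<forall>d\<in>A. compatible_charts c d) \<longrightarrow> c \<in> A)"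

definition smooth_map_on ::
  "('a::topological_space, 'e::euclidean_space) chart set \<Rightarrow>
   ('b::topological_space, 'f::euclidean_space) chart set \<Rightarrow> 'a set \<Rightarrow> ('a \<Rightarrow> 'b) \<Rightarrow> bool" where
  "smooth_map_on A B S F \<longleftrightarrow> continuous_on S F \<and>
     (\<forall>c\<in>A. \<forall>d\<in>B. smooth_on (snd c ` (fst c \<inter> S \<inter> F -` fst d)) (snd d \<circ> F \<circ> chart_inv c))"

definition smooth_curve ::
  "('a::topological_space, 'e::euclidean_space) chart set \<Rightarrow> real set \<Rightarrow> (real \<Rightarrow> 'a) \<Rightarrow> bool" where
  "smooth_curve A I \<gamma> \<longleftrightarrow> continuous_on I \<gamma> \<and>
     (\<forall>c\<in>A. smooth_on (I \<inter> \<gamma> -` fst c) (snd c \<circ> \<gamma>))"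

text \<open>
  A tangent vector at \<open>p\<close> is the family of its components in all charts around \<open>p\<close>, related by
  the derivatives of the coordinate changes, and set to 0 in all other charts, so that
  \<open>tangent_space A p\<close> is a vector space of dimension \<open>DIM('e)\<close> under pointwise operations.
  \<open>coord_vec A c p v\<close> is the tangent vector with components \<open>v\<close> in the chart \<open>c\<close>;
  for a basis vector \<open>v\<close> it is a coordinate vector of \<open>c\<close> at \<open>p\<close>.
\<close>

type_synonym ('a, 'e) tvec = "('a, 'e) chart \<Rightarrow> 'e"

definition coord_vec ::
  "('a, 'e::euclidean_space) chart set \<Rightarrow> ('a, 'e) chart \<Rightarrow> 'a \<Rightarrow> 'e \<Rightarrow> ('a, 'e) tvec" where
  "coord_vec A c p v = (\<lambda>d. if d \<in> A \<and> p \<in> fst d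
     then frechet_derivative (snd d \<circ> chart_inv c) (at (snd c p)) v else 0)"

definition tangent_space ::
  "('a, 'e::euclidean_space) chart set \<Rightarrow> 'a \<Rightarrow> ('a, 'e) tvec set" where
  "tangent_space A p = {coord_vec A c p v | c v. c \<in> A \<and> p \<in> fst c}"

definition velocity ::
  "('a, 'e::euclidean_space) chart set \<Rightarrow> (real \<Rightarrow> 'a) \<Rightarrow> real \<Rightarrow> ('a, 'e) tvec" where
  "velocity A \<gamma> t = (\<lambda>d. if d \<in> A \<and> \<gamma> t \<in> fst d
     then vector_derivative (snd d \<circ> \<gamma>) (at t) else 0)"

definition differential ::
  "('a, 'e::euclidean_space) chart set \<Rightarrow> ('b, 'f::euclidean_space) chart set \<Rightarrow> ('a \<Rightarrow> 'b) \<Rightarrow> 'a \<Rightarrow>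
   ('a, 'e) tvec \<Rightarrow> ('b, 'f) tvec" where
  "differential A B F p V = (let c = (SOME c. c \<in> A \<and> p \<in> fst c) in
     (\<lambda>d. if d \<in> B \<and> F p \<in> fst d
       then frechet_derivative (snd d \<circ> F \<circ> chart_inv c) (at (snd c p)) (V c) else 0))"

definition smooth_immersion ::
  "('a::topological_space, 'e::euclidean_space) chart set \<Rightarrow>
   ('b::topological_space, 'f::euclidean_space) chart set \<Rightarrow> ('a \<Rightarrow> 'b) \<Rightarrow> bool" where
  "smooth_immersion A B F \<longleftrightarrow> smooth_map_on A B UNIV F \<and>
     (\<forall>p. inj_on (differential A B F p) (tangent_space A p))"

definition smooth_vector_field ::
  "('a, 'e::euclidean_space) chart set \<Rightarrow> ('a \<Rightarrow> ('a, 'e) tvec) \<Rightarrow> bool" where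
  "smooth_vector_field A X \<longleftrightarrow> (\<forall>p. X p \<in> tangent_space A p) \<and>
     (\<forall>c\<in>A. smooth_on (snd c ` fst c) (\<lambda>x. X (chart_inv c x) c))"

definition smooth_real_action ::
  "('a::topological_space, 'e::euclidean_space) chart set \<Rightarrow> (real \<Rightarrow> 'a \<Rightarrow> 'a) \<Rightarrow> bool" where
  "smooth_real_action A \<phi> \<longleftrightarrow> \<phi> 0 = id \<and> (\<forall>s t. \<phi> (s + t) = \<phi> s \<circ> \<phi> t) \<and>
     continuous_on UNIV (\<lambda>(t, p). \<phi> t p) \<and>
     (\<forall>c\<in>A. \<forall>d\<in>A. smooth_on {(t, x). x \<in> snd c ` fst c \<and> \<phi> t (chart_inv c x) \<in> fst d}
        (\<lambda>(t, x). snd d (\<phi> t (chart_inv c x))))"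

text \<open>
  \<open>\<Psi>\<close> need not be injective on all of \<open>W\<close>, but it restricts to inverses of charts
  on neighbourhoods of all points of \<open>W\<close>.
\<close>

definition local_parametrization ::
  "('a, 'e::euclidean_space) chart set \<Rightarrow> 'e set \<Rightarrow> ('e \<Rightarrow> 'a) \<Rightarrow> bool" where
  "local_parametrization A W \<Psi> \<longleftrightarrow>
     (\<forall>x\<in>W. \<exists>W'. open W' \<and> x \<in> W' \<and> W' \<subseteq> W \<and> inj_on \<Psi> W' \<and> (\<Psi> ` W', inv_into W' \<Psi>) \<in> A)"


section \<open>Riemannian metrics\<close>

type_synonym ('a, 'e) metric = "'a \<Rightarrow> ('a, 'e) tvec \<Rightarrow> ('a, 'e) tvec \<Rightarrow> real"

definition metric_in_chart ::
  "('a, 'e::euclidean_space) chart set \<Rightarrow> ('a, 'e) metric \<Rightarrow> ('a, 'e) chart \<Rightarrow> 'e \<Rightarrow> 'e \<Rightarrow> 'e \<Rightarrow> real" where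
  "metric_in_chart A g c x v w =
     (let p = chart_inv c x in g p (coord_vec A c p v) (coord_vec A c p w))"

definition riemannian_metric ::
  "('a, 'e::euclidean_space) chart set \<Rightarrow> ('a, 'e) metric \<Rightarrow> bool" where
  "riemannian_metric A g \<longleftrightarrow> (\<forall>c\<in>A.
     (\<forall>x\<in>snd c ` fst c. bilinear (metric_in_chart A g c x) \<and>
        (\<forall>v w. metric_in_chart A g c x v w = metric_in_chart A g c x w v) \<and>
        (\<forall>v. v \<noteq> 0 \<longrightarrow> metric_in_chart A g c x v v > 0)) \<and>
     (\<forall>v w. smooth_on (snd c ` fst c) (\<lambda>x. metric_in_chart A g c x v w)))"

definition tangent_norm :: "('a, 'e) metric \<Rightarrow> 'a \<Rightarrow> ('a, 'e) tvec \<Rightarrow> real" where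
  "tangent_norm g p V = sqrt (g p V V)"

definition pullback_metric ::
  "('a, 'e::euclidean_space) chart set \<Rightarrow> ('b, 'f::euclidean_space) chart set \<Rightarrow> ('b, 'f) metric \<Rightarrow>
   ('a \<Rightarrow> 'b) \<Rightarrow> ('a, 'e) metric" where
  "pullback_metric A B g F p V W =
     g (F p) (differential A B F p V) (differential A B F p W)"

definition preserves_metric ::
  "('a, 'e::euclidean_space) chart set \<Rightarrow> ('a, 'e) metric \<Rightarrow> ('a \<Rightarrow> 'a) \<Rightarrow> bool" where
  "preserves_metric A g F \<longleftrightarrow> (\<forall>p. \<forall>V\<in>tangent_space A p. \<forall>W\<in>tangent_space A p.
     pullback_metric A A g F p V W = g p V W)"

text \<open>The Lie derivative of the metric along \<open>X\<close> vanishes.\<close>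

definition killing_field ::
  "('a, 'e::euclidean_space) chart set \<Rightarrow> ('a, 'e) metric \<Rightarrow> ('a \<Rightarrow> ('a, 'e) tvec) \<Rightarrow> bool" where
  "killing_field A g X \<longleftrightarrow> smooth_vector_field A X \<and>
     (\<forall>c\<in>A. \<forall>x\<in>snd c ` fst c. \<forall>v w.
        (let \<xi> = (\<lambda>y. X (chart_inv c y) c); D\<xi> = frechet_derivative \<xi> (at x) in
          frechet_derivative (\<lambda>y. metric_in_chart A g c y v w) (at x) (\<xi> x)
          + metric_in_chart A g c x (D\<xi> v) w + metric_in_chart A g c x v (D\<xi> w) = 0))"

definition isometry_flow ::
  "('a::topological_space, 'e::euclidean_space) chart set \<Rightarrow> ('a, 'e) metric \<Rightarrow>
   ('a \<Rightarrow> ('a, 'e) tvec) \<Rightarrow> (real \<Rightarrow> 'a \<Rightarrow> 'a) \<Rightarrow> bool" where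
  "isometry_flow A g X \<phi> \<longleftrightarrow> smooth_real_action A \<phi> \<and>
     (\<forall>t p. velocity A (\<lambda>s. \<phi> s p) t = X (\<phi> t p)) \<and>
     (\<forall>t. preserves_metric A g (\<phi> t))"


section \<open>Gauss curvature\<close>

text \<open>
  \<open>G i j\<close> are the coefficients of a metric on an open set of the plane.  The curvature components
  follow the convention \<open>R(\<partial>\<^sub>i, \<partial>\<^sub>j)\<partial>\<^sub>k = \<Sum>l. R\<^sup>l \<partial>\<^sub>l\<close> with
  \<open>R(\<partial>\<^sub>i, \<partial>\<^sub>j) = \<nabla>\<^sub>i\<nabla>\<^sub>j - \<nabla>\<^sub>j\<nabla>\<^sub>i\<close>, so that
  \<open>\<langle>R(\<partial>\<^sub>1, \<partial>\<^sub>2)\<partial>\<^sub>2, \<partial>\<^sub>1\<rangle>\<close> is positive on the round sphere.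
\<close>

definition partial :: "2 \<Rightarrow> (real^2 \<Rightarrow> real) \<Rightarrow> real^2 \<Rightarrow> real" where
  "partial i F x = frechet_derivative F (at x) (axis i 1)"

definition christoffel ::
  "(2 \<Rightarrow> 2 \<Rightarrow> real^2 \<Rightarrow> real) \<Rightarrow> 2 \<Rightarrow> 2 \<Rightarrow> 2 \<Rightarrow> real^2 \<Rightarrow> real" where
  "christoffel G k i j x = (\<Sum>l\<in>UNIV. matrix_inv (\<chi> m n. G m n x) $ k $ l *
     (partial i (G j l) x + partial j (G i l) x - partial l (G i j) x)) / 2"

definition curvature_component ::
  "(2 \<Rightarrow> 2 \<Rightarrow> real^2 \<Rightarrow> real) \<Rightarrow> 2 \<Rightarrow> 2 \<Rightarrow> 2 \<Rightarrow> 2 \<Rightarrow> real^2 \<Rightarrow> real" where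
  "curvature_component G l i j k x =
     partial i (christoffel G l j k) x - partial j (christoffel G l i k) x +
     (\<Sum>m\<in>UNIV. christoffel G l i m x * christoffel G m j k x
             - christoffel G l j m x * christoffel G m i k x)"

definition planar_gauss_curvature :: "(2 \<Rightarrow> 2 \<Rightarrow> real^2 \<Rightarrow> real) \<Rightarrow> real^2 \<Rightarrow> real" where
  "planar_gauss_curvature G x =
     (\<Sum>l\<in>UNIV. curvature_component G l 1 2 2 x * G l 1 x) / det (\<chi> m n. G m n x)"

text \<open>
  The Gauss curvature at a point does not depend on the chart, so it is prescribed in all charts.
\<close>

definition constant_gauss_curvature ::
  "('m, real^2) chart set \<Rightarrow> ('m, real^2) metric \<Rightarrow> real \<Rightarrow> bool" where
  "constant_gauss_curvature B h K \<longleftrightarrow> (\<forall>c\<in>B. \<forall>x\<in>snd c ` fst c.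
     planar_gauss_curvature (\<lambda>i j x. metric_in_chart B h c x (axis i 1) (axis j 1)) x = K)"


section \<open>Orbits, regular part and orbit space\<close>

text \<open>
  Groups of transformations are given as sets of maps; the group generated by a
  flow \<open>\<phi>\<close> is \<open>range \<phi>\<close>.
\<close>

definition orbit_of :: "('a \<Rightarrow> 'a) set \<Rightarrow> 'a \<Rightarrow> 'a set" where
  "orbit_of G p = (\<lambda>x. x p) ` G"

definition isotropy :: "('a \<Rightarrow> 'a) set \<Rightarrow> 'a \<Rightarrow> ('a \<Rightarrow> 'a) set" where
  "isotropy G p = {x \<in> G. x p = p}"

text \<open>
  The orbit of \<open>p\<close> is principal if its isotropy group is contained, up to conjugation,
  in those of all nearby points; passing from \<open>q\<close> to \<open>x q\<close> is the conjugation.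
\<close>

definition regular_part :: "('a::topological_space \<Rightarrow> 'a) set \<Rightarrow> 'a set" where
  "regular_part G = {p. \<exists>U. open U \<and> p \<in> U \<and>
     (\<forall>q\<in>U. \<exists>x\<in>G. isotropy G p \<subseteq> isotropy G (x q))}"

text \<open>
  The quotient of \<open>regular_part G\<close> by \<open>G\<close> with its quotient metric, up to isometry: a Riemannian
  manifold with a Riemannian submersion \<open>\<pi>\<close> onto it whose fibres are the orbits.
  \<open>(\<lambda>_. 0)\<close> is the zero tangent vector.
\<close>

definition riemannian_orbit_space ::
  "('a::topological_space, 'e::euclidean_space) chart set \<Rightarrow> ('a, 'e) metric \<Rightarrow> ('a \<Rightarrow> 'a) set \<Rightarrow>
   ('q::{t2_space, second_countable_topology}, 'f::euclidean_space) chart set \<Rightarrow> ('q, 'f) metric \<Rightarrow>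
   ('a \<Rightarrow> 'q) \<Rightarrow> bool" where
  "riemannian_orbit_space A g G Q gq \<pi> \<longleftrightarrow>
     smooth_structure Q \<and> riemannian_metric Q gq \<and>
     open (regular_part G) \<and> \<pi> ` regular_part G = UNIV \<and>
     (\<forall>p\<in>regular_part G. \<forall>q\<in>regular_part G. \<pi> p = \<pi> q \<longleftrightarrow> orbit_of G p = orbit_of G q) \<and>
     smooth_map_on A Q (regular_part G) \<pi> \<and>
     (\<forall>p\<in>regular_part G.
        differential A Q \<pi> p ` tangent_space A p = tangent_space Q (\<pi> p) \<and>
        (let vert = {Z \<in> tangent_space A p. differential A Q \<pi> p Z = (\<lambda>_. 0)};
             hor = {V \<in> tangent_space A p. \<forall>Z\<in>vert. g p V Z = 0}
         in \<forall>V\<in>hor. \<forall>W\<in>hor. pullback_metric A Q gq \<pi> p V W = g p V W))"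


section \<open>Invariant surfaces and loxodromes\<close>

text \<open>
  \<open>act x\<close> is the transformation of the surface by which \<open>x \<in> range \<phi>\<close> acts.  The action is of
  the group \<open>range \<phi>\<close> itself, so it factors through the period of \<open>\<phi>\<close> if there is one.
\<close>

definition invariant_surface ::
  "('a::topological_space, real^3) chart set \<Rightarrow> (real \<Rightarrow> 'a \<Rightarrow> 'a) \<Rightarrow>
   ('m::{t2_space, second_countable_topology}, real^2) chart set \<Rightarrow> ('m \<Rightarrow> 'a) \<Rightarrow>
   (('a \<Rightarrow> 'a) \<Rightarrow> 'm \<Rightarrow> 'm) \<Rightarrow> bool" where
  "invariant_surface A \<phi> B f act \<longleftrightarrow>
     smooth_structure B \<and> smooth_immersion B A f \<and> range f \<subseteq> regular_part (range \<phi>) \<and>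
     smooth_real_action B (\<lambda>t. act (\<phi> t)) \<and>
     (\<forall>x\<in>range \<phi>. \<forall>p. f (act x p) = x (f p))"

definition unit_speed ::
  "('a::topological_space, 'e::euclidean_space) chart set \<Rightarrow> ('a, 'e) metric \<Rightarrow> real set \<Rightarrow>
   (real \<Rightarrow> 'a) \<Rightarrow> bool" where
  "unit_speed A g I \<gamma> \<longleftrightarrow> smooth_curve A I \<gamma> \<and>
     (\<forall>t\<in>I. tangent_norm g (\<gamma> t) (velocity A \<gamma> t) = 1)"

text \<open>
  An arc length parametrized curve \<open>\<alpha>\<close> on the surface, making the angle \<open>\<theta>\<close> with \<open>X\<close>; its
  velocity is compared with \<open>X\<close> in the ambient manifold.
\<close>

definition loxodrome ::
  "('a::topological_space, real^3) chart set \<Rightarrow> ('a, real^3) metric \<Rightarrow> ('a \<Rightarrow> ('a, real^3) tvec) \<Rightarrow>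
   ('m::topological_space, real^2) chart set \<Rightarrow> ('m \<Rightarrow> 'a) \<Rightarrow> real set \<Rightarrow> (real \<Rightarrow> 'm) \<Rightarrow> real \<Rightarrow> bool" where
  "loxodrome A g X B f J \<alpha> \<theta> \<longleftrightarrow>
     open_interval J \<and> 0 \<le> \<theta> \<and> \<theta> < pi \<and> unit_speed B (pullback_metric B A g f) J \<alpha> \<and>
     (\<forall>s\<in>J. g (f (\<alpha> s)) (velocity A (f \<circ> \<alpha>) s) (X (f (\<alpha> s))) =
        tangent_norm g (f (\<alpha> s)) (X (f (\<alpha> s))) * cos \<theta>)"

end

theory Submission
  imports Defs
begin

text \<open>
  Since the action commutes with the parametrization, \<open>\<Psi>\<close> pulls the induced metric back to
  \<open>du\<^sup>2 + \<omega>\<^sup>2 dv\<^sup>2\<close>, and curvature \<open>-1/R\<^sup>2\<close> means \<open>\<omega>'' = \<omega>/R\<^sup>2\<close>.  A curve of constant angle \<open>\<theta>\<close>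
  therefore lifts locally to a curve with \<open>u' = \<plusminus>sin \<theta>\<close> and \<open>v' = cos \<theta>/\<omega>\<close>, so \<open>dv/du = \<plusminus>cot \<theta>/\<omega>\<close>,
  which is integrated by means of the first integral \<open>\<omega>\<^sup>2 - R\<^sup>2\<omega>'\<^sup>2 = a\<close>.

  \<open>\<Psi>\<close> is only a local diffeomorphism, and the point is that a global lift exists nevertheless:
  \<open>u\<close> is a function on the image of \<open>\<Psi>\<close>.  Indeed, if \<open>\<Psi> u1 v1 = \<Psi> u2 v2\<close> with \<open>u1 < u2\<close>, then the
  horizontal curves through this point coincide locally.  They cannot run in the same direction,
  because \<open>\<omega>'\<close> is strictly increasing.  If they run in opposite directions, the coincidence
  continues up to the midpoint of \<open>u1\<close> and \<open>u2\<close>, where the profile curve would have to be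
  symmetric, contradicting its unit speed.
\<close>

section \<open>Calculus of repeatedly differentiable functions\<close>

text \<open>Lying in the image of \<Psi> gives a loxodrome only pointwise preimages, and a continued
  local lift might run out of \<open>I\<close> while the curve goes on through another preimage.
  Uniqueness of u removes this: any choice of preimages has the same first coordinate, every local
  lift agrees with it, and as the square of its derivative is the constant
  \<open>(sin \<theta>)\<^sup>2\<close>, one sign is valid on all of \<open>J\<close>. For v there
  is no such uniqueness, because orbits may be closed. So v is not lifted but prescribed: a
  primitive of cot \<theta>/\<omega> with a constant fitted at one parameter. An open-closed
  argument on \<open>J\<close> then identifies the resulting curve with the loxodrome. The curvature
  thus serves twice, for the integration and for the uniqueness of u. On a circular cylinder in
  3-space with X the axial translation, \<omega> is constant, the profile circle may be traversed
  repeatedly, and u is not a function of the point.\<close>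

lemma has_derivative_cong_nhds:
  assumes "eventually (\<lambda>y. f y = g y) (nhds x)"
  shows "(f has_derivative D) (at x) \<longleftrightarrow> (g has_derivative D) (at x)"
proof -
  obtain U where "open U" "x \<in> U" "\<And>y. y \<in> U \<Longrightarrow> f y = g y"
    using assms by (auto simp: eventually_nhds)
  then show ?thesis
    by (metis has_derivative_transform_within_open)
qed

lemma differentiable_cong_nhds:
  assumes "eventually (\<lambda>y. f y = g y) (nhds x)"
  shows "f differentiable (at x) \<longleftrightarrow> g differentiable (at x)"
  using has_derivative_cong_nhds[OF assms] by (simp add: differentiable_def)

lemma frechet_derivative_cong_nhds:
  assumes "eventually (\<lambda>y. f y = g y) (nhds x)"
  shows "frechet_derivative f (at x) = frechet_derivative g (at x)"
  using has_derivative_cong_nhds[OF assms] by (simp add: frechet_derivative_def)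

lemma times_differentiable_on_cong:
  assumes "open S" "\<And>x. x \<in> S \<Longrightarrow> f x = g x"
  shows "times_differentiable_on n S f \<longleftrightarrow> times_differentiable_on n S g"
  using assms(2)
proof (induction n arbitrary: f g)
  case 0
  then show ?case using continuous_on_cong by fastforce
next
  case (Suc n)
  have ev: "eventually (\<lambda>y. f y = g y) (nhds x)" if "x \<in> S" for x
    using that Suc.prems assms(1) by (auto simp: eventually_nhds)
  have "times_differentiable_on n S (\<lambda>x. frechet_derivative f (at x) v)
      \<longleftrightarrow> times_differentiable_on n S (\<lambda>x. frechet_derivative g (at x) v)" for v
    by (rule Suc.IH) (simp add: frechet_derivative_cong_nhds[OF ev])
  then show ?case using differentiable_cong_nhds[OF ev] by simp
qed

lemma times_differentiable_on_SucD:
  "times_differentiable_on (Suc n) S f \<Longrightarrow> times_differentiable_on n S f"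
proof (induction n arbitrary: f)
  case 0
  then show ?case
    by (simp add: continuous_at_imp_continuous_on differentiable_imp_continuous_within)
next
  case (Suc n)
  then show ?case by (metis times_differentiable_on.simps(2))
qed

lemma times_differentiable_on_const: "times_differentiable_on n S (\<lambda>x. c)"
  by (induction n arbitrary: c) auto

lemma times_differentiable_on_add:
  assumes "open S"
  shows "times_differentiable_on n S f \<Longrightarrow> times_differentiable_on n S g \<Longrightarrow>
    times_differentiable_on n S (\<lambda>x. f x + g x)"
proof (induction n arbitrary: f g)
  case 0
  then show ?case by (simp add: continuous_on_add)
next
  case (Suc n)
  have "frechet_derivative (\<lambda>x. f x + g x) (at x) v =
      frechet_derivative f (at x) v + frechet_derivative g (at x) v" if "x \<in> S" for x v
  proof -
    have "((\<lambda>x. f x + g x) has_derivative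
        (\<lambda>v. frechet_derivative f (at x) v + frechet_derivative g (at x) v)) (at x)"
      using Suc.prems that by (intro has_derivative_add) (auto simp: frechet_derivative_works[symmetric])
    then show ?thesis by (simp flip: frechet_derivative_at)
  qed
  moreover have "times_differentiable_on n S
      (\<lambda>x. frechet_derivative f (at x) v + frechet_derivative g (at x) v)" for v
    using Suc by simp
  ultimately have "times_differentiable_on n S (\<lambda>x. frechet_derivative (\<lambda>x. f x + g x) (at x) v)" for v
    by (rule iffD2[OF times_differentiable_on_cong[OF assms]])
  then show ?case using Suc.prems by (auto intro: differentiable_add)
qed

lemma times_differentiable_on_sum:
  assumes "open S" "\<And>i. i \<in> I \<Longrightarrow> times_differentiable_on n S (f i)"
  shows "times_differentiable_on n S (\<lambda>x. \<Sum>i\<in>I. f i x)"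
  using assms(2)
  by (induction I rule: infinite_finite_induct)
    (auto intro: times_differentiable_on_const times_differentiable_on_add[OF assms(1)])

lemma times_differentiable_on_bounded_linear:
  assumes "open S" "bounded_linear L"
  shows "times_differentiable_on n S f \<Longrightarrow> times_differentiable_on n S (\<lambda>x. L (f x))"
proof (induction n arbitrary: f)
  case 0
  then show ?case by (simp add: assms(2) linear_continuous_on_compose bounded_linear.continuous_on)
next
  case (Suc n)
  have D: "((\<lambda>x. L (f x)) has_derivative (\<lambda>v. L (frechet_derivative f (at x) v))) (at x)" if "x \<in> S" for x
    using Suc.prems that
    by (intro bounded_linear.has_derivative[OF assms(2)]) (auto simp: frechet_derivative_works[symmetric])
  have "frechet_derivative (\<lambda>x. L (f x)) (at x) v = L (frechet_derivative f (at x) v)" if "x \<in> S" for x v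
    using D[OF that] by (simp flip: frechet_derivative_at)
  moreover have "times_differentiable_on n S (\<lambda>x. L (frechet_derivative f (at x) v))" for v
    using Suc by simp
  ultimately have "times_differentiable_on n S (\<lambda>x. frechet_derivative (\<lambda>x. L (f x)) (at x) v)" for v
    by (rule iffD2[OF times_differentiable_on_cong[OF assms(1)]])
  then show ?case using D by (auto simp: differentiable_def)
qed

lemma times_differentiable_on_scaleR:
  assumes "open S"
  shows "times_differentiable_on n S f \<Longrightarrow> times_differentiable_on n S g \<Longrightarrow>
    times_differentiable_on n S (\<lambda>x. f x *\<^sub>R g x)"
proof (induction n arbitrary: f g)
  case 0
  then show ?case by (simp add: continuous_on_scaleR)
next
  case (Suc n)
  let ?D = "\<lambda>x v. f x *\<^sub>R frechet_derivative g (at x) v + frechet_derivative f (at x) v *\<^sub>R g x"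
  have D: "((\<lambda>x. f x *\<^sub>R g x) has_derivative ?D x) (at x)" if "x \<in> S" for x
    using Suc.prems that by (intro has_derivative_scaleR) (auto simp: frechet_derivative_works[symmetric])
  have "frechet_derivative (\<lambda>x. f x *\<^sub>R g x) (at x) v = ?D x v" if "x \<in> S" for x v
    using D[OF that] by (simp flip: frechet_derivative_at)
  moreover have "times_differentiable_on n S (\<lambda>x. ?D x v)" for v
    using Suc.prems times_differentiable_on_SucD[OF Suc.prems(1)] times_differentiable_on_SucD[OF Suc.prems(2)]
    by (intro times_differentiable_on_add[OF assms] Suc.IH) simp_all
  ultimately have "times_differentiable_on n S (\<lambda>x. frechet_derivative (\<lambda>x. f x *\<^sub>R g x) (at x) v)" for v
    by (rule iffD2[OF times_differentiable_on_cong[OF assms]])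
  then show ?case using D by (auto simp: differentiable_def)
qed

lemma times_differentiable_on_compose:
  fixes f :: "'a::real_normed_vector \<Rightarrow> 'b::euclidean_space"
  assumes "open S" "open T" "f ` S \<subseteq> T"
  shows "times_differentiable_on n S f \<Longrightarrow> times_differentiable_on n T g \<Longrightarrow>
    times_differentiable_on n S (\<lambda>x. g (f x))"
proof (induction n arbitrary: g)
  case 0
  then show ?case using assms(3) continuous_on_compose2 by auto
next
  case (Suc n)
  let ?Df = "\<lambda>x. frechet_derivative f (at x)" and ?Dg = "\<lambda>x. frechet_derivative g (at (f x))"
  have f: "(f has_derivative ?Df x) (at x)" if "x \<in> S" for x
    using Suc.prems(1) that by (auto simp: frechet_derivative_works[symmetric])
  have g: "(g has_derivative ?Dg x) (at (f x))" if "x \<in> S" for x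
    using Suc.prems(2) that assms(3) by (auto simp: frechet_derivative_works[symmetric])
  have D: "((\<lambda>x. g (f x)) has_derivative (\<lambda>v. ?Dg x (?Df x v))) (at x)" if "x \<in> S" for x
    using diff_chain_at[OF f[OF that] g[OF that]] by (simp add: o_def)
  \<comment> \<open>In the chain rule the outer derivative is taken in the direction
    \<open>?Df x v\<close>, which moves with \<open>x\<close>, while the definition controls
    derivatives in fixed directions only. Expanding in a basis leaves fixed directions
    \<open>b\<close> with scalar coefficients.\<close>
  have "frechet_derivative (\<lambda>x. g (f x)) (at x) v = (\<Sum>b\<in>Basis. (?Df x v \<bullet> b) *\<^sub>R ?Dg x b)"
    if "x \<in> S" for x v
  proof -
    have "frechet_derivative (\<lambda>x. g (f x)) (at x) v = ?Dg x (\<Sum>b\<in>Basis. (?Df x v \<bullet> b) *\<^sub>R b)"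
      using D[OF that] by (simp add: euclidean_representation flip: frechet_derivative_at)
    also have "\<dots> = (\<Sum>b\<in>Basis. (?Df x v \<bullet> b) *\<^sub>R ?Dg x b)"
      using has_derivative_linear[OF g[OF that]] by (simp add: linear_sum linear_scale)
    finally show ?thesis .
  qed
  moreover have "times_differentiable_on n S (\<lambda>x. \<Sum>b\<in>Basis. (?Df x v \<bullet> b) *\<^sub>R ?Dg x b)" for v
  proof (intro times_differentiable_on_sum times_differentiable_on_scaleR assms(1))
    fix b :: 'b
    show "times_differentiable_on n S (\<lambda>x. ?Df x v \<bullet> b)"
      using Suc.prems(1) by (intro times_differentiable_on_bounded_linear[OF assms(1) bounded_linear_inner_left]) simp
    show "times_differentiable_on n S (\<lambda>x. ?Dg x b)"
      using Suc.prems times_differentiable_on_SucD[OF Suc.prems(1)]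
      by (intro Suc.IH[of "\<lambda>y. frechet_derivative g (at y) b"]) simp_all
  qed
  ultimately have "times_differentiable_on n S (\<lambda>x. frechet_derivative (\<lambda>x. g (f x)) (at x) v)" for v
    by (rule iffD2[OF times_differentiable_on_cong[OF assms(1)]])
  then show ?case using D by (auto simp: differentiable_def)
qed

lemma smooth_on_imp_differentiable: "smooth_on S f \<Longrightarrow> x \<in> S \<Longrightarrow> f differentiable (at x)"
  unfolding smooth_on_def by (metis times_differentiable_on.simps(2))

lemma times_differentiable_on_2_real:
  fixes E :: "real \<Rightarrow> real"
  assumes "times_differentiable_on 2 S E" "u \<in> S"
  shows "(E has_real_derivative frechet_derivative E (at u) 1) (at u)"
    and "(\<lambda>u. frechet_derivative E (at u) 1) differentiable (at u)"
proof -
  have "times_differentiable_on (Suc (Suc 0)) S E"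
    using assms(1) by (simp add: numeral_2_eq_2)
  then have "E differentiable (at u)" "(\<lambda>u. frechet_derivative E (at u) 1) differentiable (at u)"
    using assms(2) by auto
  then show "(\<lambda>u. frechet_derivative E (at u) 1) differentiable (at u)"
    by simp
  have "(E has_derivative frechet_derivative E (at u)) (at u)"
    using \<open>E differentiable (at u)\<close> by (simp add: frechet_derivative_works)
  moreover have "frechet_derivative E (at u) v = frechet_derivative E (at u) 1 * v" for v
    using linear_scale[OF linear_frechet_derivative[OF \<open>E differentiable (at u)\<close>], of v 1] by simp
  ultimately show "(E has_real_derivative frechet_derivative E (at u) 1) (at u)"
    by (metis has_derivative_imp_has_field_derivative mult.commute)
qed

text \<open>In arc length the first coordinate of a loxodrome turns out to be affine, so this
  supplies the smoothness of the reparametrization.\<close>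

lemma smooth_on_affine: "smooth_on S (\<lambda>s::real. p + q * (s - r))"
proof -
  have D: "((\<lambda>s::real. p + q * (s - r)) has_derivative (\<lambda>v. q * v)) (at x)" for x
    by (auto intro!: derivative_eq_intros)
  then have "frechet_derivative (\<lambda>s::real. p + q * (s - r)) (at x) v = q * v" for x v
    by (metis frechet_derivative_at)
  moreover have "(\<lambda>s::real. p + q * (s - r)) differentiable (at x)" for x
    using D by (auto simp: differentiable_def)
  moreover have "continuous_on S (\<lambda>s::real. p + q * (s - r))"
    by (intro continuous_intros)
  ultimately have "times_differentiable_on n S (\<lambda>s::real. p + q * (s - r))" for n
    by (cases n) (auto intro: times_differentiable_on_const)
  then show ?thesis
    by (simp add: smooth_on_def)
qed

section \<open>Derivatives of maps into manifolds\<close>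

lemma eventually_nhds_isCont:
  assumes "isCont F x" "open U" "F x \<in> U"
  shows "eventually (\<lambda>y. F y \<in> U) (nhds x)"
proof -
  have "eventually (\<lambda>y. F y \<in> U) (at x)"
    using assms by (auto simp: isCont_def dest: topological_tendstoD)
  then show ?thesis
    using assms(3) by (auto simp: eventually_at_filter elim: eventually_mono)
qed

lemma
  assumes "is_chart c"
  shows chart_inv_left: "p \<in> fst c \<Longrightarrow> chart_inv c (snd c p) = p"
    and chart_inv_mem: "x \<in> snd c ` fst c \<Longrightarrow> chart_inv c x \<in> fst c"
    and chart_inv_right: "x \<in> snd c ` fst c \<Longrightarrow> snd c (chart_inv c x) = x"
    and isCont_chart_inv: "x \<in> snd c ` fst c \<Longrightarrow> isCont (chart_inv c) x"
    and open_chart_domain: "open (fst c)"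
    and open_chart_range: "open (snd c ` fst c)"
proof -
  have h: "open (fst c)" "open (snd c ` fst c)"
      "homeomorphism (fst c) (snd c ` fst c) (snd c) (chart_inv c)"
    using assms by (auto simp: is_chart_def)
  then show "p \<in> fst c \<Longrightarrow> chart_inv c (snd c p) = p"
    and "x \<in> snd c ` fst c \<Longrightarrow> chart_inv c x \<in> fst c"
    and "x \<in> snd c ` fst c \<Longrightarrow> snd c (chart_inv c x) = x"
    and "x \<in> snd c ` fst c \<Longrightarrow> isCont (chart_inv c) x"
    and "open (fst c)" and "open (snd c ` fst c)"
    by (auto simp: homeomorphism_def continuous_on_eq_continuous_at)
qed

lemma
  assumes "smooth_structure A"
  shows smooth_structure_is_chart: "c \<in> A \<Longrightarrow> is_chart c"
    and smooth_structure_covers: "\<exists>c\<in>A. p \<in> fst c"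
    and smooth_structure_transition: "c \<in> A \<Longrightarrow> d \<in> A \<Longrightarrow>
      smooth_on (snd c ` (fst c \<inter> fst d)) (snd d \<circ> chart_inv c)"
  using assms by (auto simp: smooth_structure_def compatible_charts_def)

definition differentiable_into ::
  "('a::topological_space, 'e::euclidean_space) chart set \<Rightarrow> ('c::real_normed_vector \<Rightarrow> 'a) \<Rightarrow> 'c \<Rightarrow> bool" where
  "differentiable_into A F x \<longleftrightarrow> isCont F x \<and>
     (\<forall>d\<in>A. F x \<in> fst d \<longrightarrow> (snd d \<circ> F) differentiable (at x))"

text \<open>A common form for three kinds of tangent vectors: velocities of curves (the image of 1),
  coordinate vectors (images under an inverse chart), and images of parameter directions. One chain
  rule then serves them all.\<close>

definition pushforward ::
  "('a, 'e::euclidean_space) chart set \<Rightarrow> ('c::real_normed_vector \<Rightarrow> 'a) \<Rightarrow> 'c \<Rightarrow> 'c \<Rightarrow> ('a, 'e) tvec" where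
  "pushforward A F x v = (\<lambda>d. if d \<in> A \<and> F x \<in> fst d
     then frechet_derivative (snd d \<circ> F) (at x) v else 0)"

definition differentiable_between ::
  "('a::t2_space, 'e::euclidean_space) chart set \<Rightarrow> ('b::topological_space, 'f::euclidean_space) chart set \<Rightarrow>
   ('a \<Rightarrow> 'b) \<Rightarrow> 'a \<Rightarrow> bool" where
  "differentiable_between A B f p \<longleftrightarrow> isCont f p \<and>
     (\<forall>c\<in>A. \<forall>d\<in>B. p \<in> fst c \<longrightarrow> f p \<in> fst d \<longrightarrow>
        (snd d \<circ> f \<circ> chart_inv c) differentiable (at (snd c p)))"

lemma differentiable_into_cong:
  fixes F G :: "'c::real_normed_vector \<Rightarrow> 'a::topological_space"
    and A :: "('a, 'e::euclidean_space) chart set"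
  assumes "eventually (\<lambda>y. F y = G y) (nhds x)"
  shows "differentiable_into A F x \<longleftrightarrow> differentiable_into A G x"
    and "pushforward A F x = pushforward A G x"
proof -
  have "F x = G x"
    using assms by (rule eventually_nhds_x_imp_x)
  moreover have "eventually (\<lambda>y. (snd d \<circ> F) y = (snd d \<circ> G) y) (nhds x)" for d :: "('a, 'e) chart"
    using assms by (rule eventually_mono) simp
  then have "(snd d \<circ> F) differentiable (at x) \<longleftrightarrow> (snd d \<circ> G) differentiable (at x)"
    "frechet_derivative (snd d \<circ> F) (at x) = frechet_derivative (snd d \<circ> G) (at x)" for d :: "('a, 'e) chart"
    by (rule differentiable_cong_nhds, rule frechet_derivative_cong_nhds)
  ultimately show "differentiable_into A F x \<longleftrightarrow> differentiable_into A G x"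
    "pushforward A F x = pushforward A G x"
    using isCont_cong[OF assms] by (simp_all add: differentiable_into_def pushforward_def fun_eq_iff cong: if_cong)
qed

lemma differentiable_into_compose:
  fixes F :: "'c::real_normed_vector \<Rightarrow> 'a::topological_space"
    and A :: "('a, 'e::euclidean_space) chart set"
  assumes "differentiable_into A F (k y)" "k differentiable (at y)"
  shows "differentiable_into A (\<lambda>z. F (k z)) y"
    and "pushforward A (\<lambda>z. F (k z)) y w = pushforward A F (k y) (frechet_derivative k (at y) w)"
proof -
  have cont: "isCont (\<lambda>z. F (k z)) y"
    using assms differentiable_imp_continuous_within[OF assms(2)]
    by (auto simp: differentiable_into_def intro: isCont_o2)
  have d: "(snd d \<circ> F) differentiable (at (k y))" if "d \<in> A" "F (k y) \<in> fst d" for d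
    using assms(1) that by (simp add: differentiable_into_def)
  have o: "snd d \<circ> (\<lambda>z. F (k z)) = (snd d \<circ> F) \<circ> k" for d :: "('a, 'e) chart"
    by (simp add: o_def)
  show "differentiable_into A (\<lambda>z. F (k z)) y"
    unfolding differentiable_into_def o using cont assms(2) d by (auto intro: differentiable_chain_at)
  show "pushforward A (\<lambda>z. F (k z)) y w = pushforward A F (k y) (frechet_derivative k (at y) w)"
    unfolding pushforward_def o using assms(2) d by (auto simp: frechet_derivative_compose fun_eq_iff)
qed

lemma has_derivative_through_chart:
  assumes A: "smooth_structure A" and F: "differentiable_into A F x"
    and c: "c \<in> A" "F x \<in> fst c"
    and f: "(snd d \<circ> f \<circ> chart_inv c) differentiable (at (snd c (F x)))"
  shows "((\<lambda>y. snd d (f (F y))) has_derivative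
    (frechet_derivative (snd d \<circ> f \<circ> chart_inv c) (at (snd c (F x)))
      \<circ> frechet_derivative (snd c \<circ> F) (at x))) (at x)"
proof -
  have "is_chart c"
    using A c(1) by (rule smooth_structure_is_chart)
  have "eventually (\<lambda>y. F y \<in> fst c) (nhds x)"
    using F c open_chart_domain[OF \<open>is_chart c\<close>]
    by (intro eventually_nhds_isCont) (auto simp: differentiable_into_def)
  then have ev: "eventually (\<lambda>y. ((snd d \<circ> f \<circ> chart_inv c) \<circ> (snd c \<circ> F)) y = snd d (f (F y))) (nhds x)"
    by (rule eventually_mono) (simp add: chart_inv_left[OF \<open>is_chart c\<close>])
  have "((snd c \<circ> F) has_derivative frechet_derivative (snd c \<circ> F) (at x)) (at x)"
    using F c by (simp add: differentiable_into_def frechet_derivative_works)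
  moreover have "((snd d \<circ> f \<circ> chart_inv c) has_derivative
      frechet_derivative (snd d \<circ> f \<circ> chart_inv c) (at (snd c (F x)))) (at ((snd c \<circ> F) x))"
    using f by (simp add: frechet_derivative_works)
  ultimately show ?thesis
    using diff_chain_at has_derivative_cong_nhds[OF ev] by blast
qed

text \<open>\<open>differential\<close> works through an arbitrarily chosen chart. On a vector that
  is itself a pushforward the choice disappears, because chart and inverse chart cancel near the
  point.\<close>

lemma differential_pushforward:
  assumes "smooth_structure A" "differentiable_between A B f (F x)" "differentiable_into A F x"
  shows "differentiable_into B (\<lambda>y. f (F y)) x"
    and "differential A B f (F x) (pushforward A F x v) = pushforward B (\<lambda>y. f (F y)) x v"
proof -
  have der: "((snd d \<circ> (\<lambda>y. f (F y))) has_derivative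
      (frechet_derivative (snd d \<circ> f \<circ> chart_inv c) (at (snd c (F x)))
        \<circ> frechet_derivative (snd c \<circ> F) (at x))) (at x)"
    if "c \<in> A" "F x \<in> fst c" "d \<in> B" "f (F x) \<in> fst d" for c d
    using has_derivative_through_chart[OF assms(1,3) that(1,2), of d f] assms(2) that
    by (auto simp: differentiable_between_def o_def)
  obtain c0 where "c0 \<in> A \<and> F x \<in> fst c0"
    using smooth_structure_covers[OF assms(1)] by blast
  define c where "c = (SOME c. c \<in> A \<and> F x \<in> fst c)"
  have c: "c \<in> A \<and> F x \<in> fst c"
    unfolding c_def by (rule someI) fact
  have "isCont (\<lambda>y. f (F y)) x"
    using assms by (auto simp: differentiable_into_def differentiable_between_def intro: isCont_o2)
  then show "differentiable_into B (\<lambda>y. f (F y)) x"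
    using der[of c] c by (auto simp: differentiable_into_def differentiable_def)
  have "frechet_derivative (snd d \<circ> (\<lambda>y. f (F y))) (at x) v =
      frechet_derivative (snd d \<circ> f \<circ> chart_inv c) (at (snd c (F x)))
        (frechet_derivative (snd c \<circ> F) (at x) v)" if "d \<in> B" "f (F x) \<in> fst d" for d
    using frechet_derivative_at[OF der[of c d]] that c by (metis comp_apply)
  then show "differential A B f (F x) (pushforward A F x v) = pushforward B (\<lambda>y. f (F y)) x v"
    unfolding differential_def c_def[symmetric] Let_def
    using c by (auto simp: pushforward_def fun_eq_iff)
qed

lemma pushforward_eq_coord_vec:
  assumes A: "smooth_structure A" and F: "differentiable_into A F x" and c: "c \<in> A" "F x \<in> fst c"
  shows "pushforward A F x v = coord_vec A c (F x) (pushforward A F x v c)"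
proof -
  have eq: "frechet_derivative (snd d \<circ> F) (at x) v =
      frechet_derivative (snd d \<circ> chart_inv c) (at (snd c (F x))) (frechet_derivative (snd c \<circ> F) (at x) v)"
    if "d \<in> A" "F x \<in> fst d" for d
  proof -
    have "(snd d \<circ> chart_inv c) differentiable (at (snd c (F x)))"
      using smooth_structure_transition[OF A c(1) that(1)] c that
      by (intro smooth_on_imp_differentiable) auto
    then have "((\<lambda>y. snd d (F y)) has_derivative
        (frechet_derivative (snd d \<circ> chart_inv c) (at (snd c (F x)))
          \<circ> frechet_derivative (snd c \<circ> F) (at x))) (at x)"
      \<comment> \<open>With the identity as the outer map, the chain rule becomes the
        transformation law of components under a change of chart.\<close>
      using has_derivative_through_chart[OF A F c, of d id] by (simp add: o_def)
    from frechet_derivative_at[OF this, symmetric] show ?thesis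
      by (simp add: o_def)
  qed
  show ?thesis
  proof
    fix d
    show "pushforward A F x v d = coord_vec A c (F x) (pushforward A F x v c) d"
      unfolding pushforward_def coord_vec_def using c eq[of d] by simp
  qed
qed

lemma differentiable_into_chart_inv:
  assumes A: "smooth_structure A" and c: "c \<in> A" "x \<in> snd c ` fst c"
  shows "differentiable_into A (chart_inv c) x"
    and "coord_vec A c (chart_inv c x) v = pushforward A (chart_inv c) x v"
proof -
  have ic: "is_chart c"
    using A c(1) by (rule smooth_structure_is_chart)
  have x: "x \<in> snd c ` (fst c \<inter> fst d)" if "chart_inv c x \<in> fst d" for d
    using that chart_inv_mem[OF ic c(2)] chart_inv_right[OF ic c(2)] by (metis IntI image_eqI)
  show "differentiable_into A (chart_inv c) x"
    unfolding differentiable_into_def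
    using isCont_chart_inv[OF ic c(2)] smooth_on_imp_differentiable[OF smooth_structure_transition[OF A c(1)] x]
    by blast
  show "coord_vec A c (chart_inv c x) v = pushforward A (chart_inv c) x v"
    unfolding coord_vec_def pushforward_def chart_inv_right[OF ic c(2)] ..
qed

text \<open>Membership in the tangent space provides components in some chart \<open>d\<close> only.
  The coordinate vector of \<open>d\<close> is a pushforward under the inverse of \<open>d\<close>,
  and a pushforward can be read off in any chart.\<close>

lemma tangent_space_coord_vec:
  assumes A: "smooth_structure A" and V: "V \<in> tangent_space A p" and c: "c \<in> A" "p \<in> fst c"
  shows "V = coord_vec A c p (V c)"
proof -
  obtain d v where d: "d \<in> A" "p \<in> fst d" and V: "V = coord_vec A d p v"
    using V by (auto simp: tangent_space_def)
  have p: "chart_inv d (snd d p) = p"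
    using chart_inv_left[OF smooth_structure_is_chart[OF A d(1)] d(2)] .
  show ?thesis
    unfolding V
    using differentiable_into_chart_inv[OF A d(1), of "snd d p"] pushforward_eq_coord_vec[OF A _ c(1), of "chart_inv d" "snd d p" v] d c
    by (simp add: p)
qed

lemma pushforward_in_tangent_space:
  assumes A: "smooth_structure A" and F: "differentiable_into A F x"
  shows "pushforward A F x v \<in> tangent_space A (F x)"
proof -
  obtain c where "c \<in> A" "F x \<in> fst c"
    using smooth_structure_covers[OF A] by blast
  then show ?thesis
    unfolding tangent_space_def mem_Collect_eq using pushforward_eq_coord_vec[OF A F] by blast
qed

lemma metric_coord_vec:
  assumes "smooth_structure A" "c \<in> A" "p \<in> fst c"
  shows "g p (coord_vec A c p v) (coord_vec A c p w) = metric_in_chart A g c (snd c p) v w"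
  using chart_inv_left[OF smooth_structure_is_chart[OF assms(1,2)] assms(3)]
  by (simp add: metric_in_chart_def)

lemma linear_pushforward:
  assumes "differentiable_into A F x"
  shows "linear (\<lambda>v. pushforward A F x v d)"
proof (cases "d \<in> A \<and> F x \<in> fst d")
  case True
  then have "linear (frechet_derivative (snd d \<circ> F) (at x))"
    using assms by (intro linear_frechet_derivative) (simp add: differentiable_into_def)
  then show ?thesis
    using True by (simp add: pushforward_def)
qed (auto simp: pushforward_def intro: linear_zero)

lemma bilinear_pushforward_metric:
  assumes A: "smooth_structure A" and g: "riemannian_metric A g" and F: "differentiable_into A F x"
  shows "bilinear (\<lambda>v w. g (F x) (pushforward A F x v) (pushforward A F x w))" (is "bilinear ?b")
    and "g (F x) (pushforward A F x v) (pushforward A F x w) = g (F x) (pushforward A F x w) (pushforward A F x v)"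
proof -
  obtain c where c: "c \<in> A" "F x \<in> fst c"
    using smooth_structure_covers[OF A] by blast
  let ?m = "metric_in_chart A g c (snd c (F x))" and ?L = "\<lambda>v. pushforward A F x v c"
  have b: "?b v w = ?m (?L v) (?L w)" for v w
    using pushforward_eq_coord_vec[OF A F c] metric_coord_vec[where g = g, OF A c] by metis
  have m: "bilinear ?m" "?m v w = ?m w v" for v w
    using g c by (auto simp: riemannian_metric_def)
  have L: "linear ?L"
    using F by (rule linear_pushforward)
  show "bilinear ?b"
    unfolding b bilinear_def
    using m(1) L unfolding bilinear_def by (auto intro: linear_compose[unfolded o_def])
  show "g (F x) (pushforward A F x v) (pushforward A F x w) = g (F x) (pushforward A F x w) (pushforward A F x v)"
    unfolding b by (rule m(2))
qed

lemma metric_pos: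
  assumes A: "smooth_structure A" and g: "riemannian_metric A g"
    and V: "V \<in> tangent_space A p" "V \<noteq> (\<lambda>_. 0)"
  shows "g p V V > 0"
proof -
  obtain c where c: "c \<in> A" "p \<in> fst c"
    using smooth_structure_covers[OF A] by blast
  have V': "V = coord_vec A c p (V c)"
    by (rule tangent_space_coord_vec[OF A V(1) c])
  have ic: "is_chart c" and p: "snd c p \<in> snd c ` fst c" "chart_inv c (snd c p) = p"
    using smooth_structure_is_chart[OF A c(1)] c(2) by (auto simp: chart_inv_left)
  have "V c \<noteq> 0"
  proof
    assume "V c = 0"
    then have "V = coord_vec A c p 0" using V' by simp
    also have "\<dots> = pushforward A (chart_inv c) (snd c p) 0"
      using differentiable_into_chart_inv(2)[OF A c(1) p(1)] p(2) by simp
    also have "\<dots> = (\<lambda>_. 0)"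
      using linear_0[OF linear_pushforward[OF differentiable_into_chart_inv(1)[OF A c(1) p(1)]]] by auto
    finally show False using V(2) by simp
  qed
  then have "metric_in_chart A g c (snd c p) (V c) (V c) > 0"
    using g c by (auto simp: riemannian_metric_def)
  then show ?thesis
    using V' metric_coord_vec[where g = g, OF A c] by metis
qed

lemma velocity_eq_pushforward:
  assumes "differentiable_into A \<gamma> t"
  shows "velocity A \<gamma> t = pushforward A \<gamma> t 1"
  using assms by (auto simp: velocity_def pushforward_def differentiable_into_def
      frechet_derivative_eq_vector_derivative fun_eq_iff)

lemma smooth_curve_differentiable_into:
  assumes "smooth_curve A I \<gamma>" "open I" "t \<in> I"
  shows "differentiable_into A \<gamma> t"
proof -
  have "isCont \<gamma> t"
    using assms by (auto simp: smooth_curve_def continuous_on_eq_continuous_at)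
  moreover have "(snd d \<circ> \<gamma>) differentiable (at t)" if "d \<in> A" "\<gamma> t \<in> fst d" for d
    using assms that by (intro smooth_on_imp_differentiable[of "I \<inter> \<gamma> -` fst d"]) (auto simp: smooth_curve_def)
  ultimately show ?thesis
    by (simp add: differentiable_into_def)
qed

lemma smooth_map_on_differentiable_between:
  assumes "smooth_map_on A B S f" "open S" "p \<in> S"
  shows "differentiable_between A B f p"
proof -
  have "isCont f p"
    using assms by (auto simp: smooth_map_on_def continuous_on_eq_continuous_at)
  moreover have "(snd d \<circ> f \<circ> chart_inv c) differentiable (at (snd c p))"
    if "c \<in> A" "d \<in> B" "p \<in> fst c" "f p \<in> fst d" for c d
    using assms that
    by (intro smooth_on_imp_differentiable[of "snd c ` (fst c \<inter> S \<inter> f -` fst d)"]) (auto simp: smooth_map_on_def)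
  ultimately show ?thesis
    by (simp add: differentiable_between_def)
qed

section \<open>Flows of isometries\<close>

text \<open>Joint smoothness is restricted to slices: compose with the affine inclusions of a fixed
  time or of a fixed point.\<close>

lemma smooth_real_action_differentiable:
  fixes A :: "('a::{t2_space,second_countable_topology}, 'e::euclidean_space) chart set"
  assumes A: "smooth_structure A" and \<phi>: "smooth_real_action A \<phi>"
  shows "differentiable_between A A (\<phi> t) p" and "differentiable_into A (\<lambda>s. \<phi> s p) t"
proof -
  have "isCont (\<lambda>(t, p). \<phi> t p) (t, p)"
    using \<phi> by (auto simp: smooth_real_action_def continuous_on_eq_continuous_at)
  then have cont: "isCont (\<phi> t) p" "isCont (\<lambda>s. \<phi> s p) t"
    using isCont_o2[of p "Pair t" "\<lambda>(t, p). \<phi> t p"] isCont_o2[of t "\<lambda>s. (s, p)" "\<lambda>(t, p). \<phi> t p"]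
    by (simp_all add: continuous_Pair)
  have D: "(\<lambda>(t, x). snd d (\<phi> t (chart_inv c x))) differentiable (at (t, snd c p))"
    if "c \<in> A" "d \<in> A" "p \<in> fst c" "\<phi> t p \<in> fst d" for c d
  proof -
    have "chart_inv c (snd c p) = p"
      using chart_inv_left smooth_structure_is_chart A that by blast
    then have "(t, snd c p) \<in> {(t, x). x \<in> snd c ` fst c \<and> \<phi> t (chart_inv c x) \<in> fst d}"
      using that by auto
    moreover have "smooth_on {(t, x). x \<in> snd c ` fst c \<and> \<phi> t (chart_inv c x) \<in> fst d}
        (\<lambda>(t, x). snd d (\<phi> t (chart_inv c x)))"
      using \<phi> that(1,2) unfolding smooth_real_action_def by blast
    ultimately show ?thesis
      by (rule smooth_on_imp_differentiable[rotated])
  qed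
  have "(snd d \<circ> \<phi> t \<circ> chart_inv c) differentiable (at (snd c p))"
    if "c \<in> A" "d \<in> A" "p \<in> fst c" "\<phi> t p \<in> fst d" for c d
  proof -
    have "(\<lambda>x. (t, x)) differentiable (at (snd c p))"
      by (auto simp: differentiable_def intro!: exI derivative_eq_intros)
    from differentiable_chain_at[OF this D[OF that]] show ?thesis
      by (simp add: o_def)
  qed
  then show "differentiable_between A A (\<phi> t) p"
    using cont by (simp add: differentiable_between_def)
  have "(snd d \<circ> (\<lambda>s. \<phi> s p)) differentiable (at t)" if "d \<in> A" "\<phi> t p \<in> fst d" for d
  proof -
    obtain c where c: "c \<in> A" "p \<in> fst c"
      using smooth_structure_covers[OF A] by blast
    have p: "chart_inv c (snd c p) = p"
      using chart_inv_left smooth_structure_is_chart A c by blast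
    have "(\<lambda>s. (s, snd c p)) differentiable (at t)"
      by (auto simp: differentiable_def intro!: exI derivative_eq_intros)
    from differentiable_chain_at[OF this D[OF c(1) that(1) c(2) that(2)]] show ?thesis
      by (simp add: o_def p)
  qed
  then show "differentiable_into A (\<lambda>s. \<phi> s p) t"
    using cont by (simp add: differentiable_into_def)
qed

lemma
  fixes A :: "('a::{t2_space,second_countable_topology}, 'e::euclidean_space) chart set"
  assumes A: "smooth_structure A" and \<phi>: "smooth_real_action A \<phi>"
  shows smooth_real_action_0: "\<phi> 0 p = p" and smooth_real_action_add: "\<phi> (s + t) p = \<phi> s (\<phi> t p)"
  using \<phi> by (simp_all add: smooth_real_action_def)

text \<open>The third claim is the invariance of X under its own flow: \<open>\<phi> t\<close> maps
  the orbit curve through \<open>p\<close> to the same curve with time shifted by \<open>t\<close>,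
  so it maps the velocity at 0 to the velocity at \<open>t\<close>.\<close>

lemma isometry_flow_field:
  fixes A :: "('a::{t2_space,second_countable_topology}, 'e::euclidean_space) chart set"
  assumes A: "smooth_structure A" and \<phi>: "isometry_flow A g X \<phi>"
  shows "X (\<phi> t p) = pushforward A (\<lambda>s. \<phi> s p) t 1"
    and "X p \<in> tangent_space A p"
    and "differential A A (\<phi> t) p (X p) = X (\<phi> t p)"
proof -
  have act: "smooth_real_action A \<phi>"
    using \<phi> by (simp add: isometry_flow_def)
  note diff = smooth_real_action_differentiable[OF A act]
  show X: "X (\<phi> t p) = pushforward A (\<lambda>s. \<phi> s p) t 1" for t
    using \<phi> velocity_eq_pushforward[OF diff(2)] by (metis isometry_flow_def)
  have X0: "X p = pushforward A (\<lambda>s. \<phi> s p) 0 1"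
    using X[where t = 0] by (simp add: smooth_real_action_0[OF A act])
  then show "X p \<in> tangent_space A p"
    using pushforward_in_tangent_space[OF A diff(2), where x = 0] by (simp add: smooth_real_action_0[OF A act])
  have shift: "((\<lambda>s. t + s) has_derivative (\<lambda>v. v)) (at 0)"
    by (auto intro!: derivative_eq_intros)
  have "differential A A (\<phi> t) p (X p) = pushforward A (\<lambda>s. \<phi> t (\<phi> s p)) 0 1"
    using differential_pushforward(2)[OF A _ diff(2), where B = A and f = "\<phi> t" and x = 0 and v = 1] diff(1) X0
    by (simp add: smooth_real_action_0[OF A act])
  also have "\<dots> = pushforward A (\<lambda>s. \<phi> (t + s) p) 0 1"
    by (simp add: smooth_real_action_add[OF A act])
  also have "\<dots> = pushforward A (\<lambda>s. \<phi> s p) t 1"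
    using differentiable_into_compose(2)[of A "\<lambda>s. \<phi> s p" "\<lambda>s. t + s" 0 1] diff(2) shift
    by (simp add: differentiable_def exI[of _ "\<lambda>v. v"] flip: frechet_derivative_at[OF shift])
  finally show "differential A A (\<phi> t) p (X p) = X (\<phi> t p)"
    by (simp add: X)
qed

text \<open>Rank and nullity by hand: a second independent kernel vector, together with a right
  inverse of \<open>L\<close>, would embed a space of dimension 4 in one of dimension 3. Applied to
  the orbit projection, it makes X span the vertical directions.\<close>

lemma linear_kernel_codim_one:
  fixes L :: "real^3 \<Rightarrow> real^2"
  assumes L: "linear L" "surj L" and \<xi>: "L \<xi> = 0" "\<xi> \<noteq> 0" and z: "L z = 0"
  shows "\<exists>k. z = k *\<^sub>R \<xi>"
proof (rule ccontr)
  assume nz: "\<not> ?thesis"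
  obtain h where h: "linear h" "L \<circ> h = id"
    using linear_surjective_right_inverse[OF L] by blast
  define T where "T = (\<lambda>(a::real, b::real, y::real^2). a *\<^sub>R \<xi> + b *\<^sub>R z + h y)"
  have "linear T"
    by (auto intro!: linearI simp: T_def linear_add[OF h(1)] linear_scale[OF h(1)] algebra_simps split: prod.splits)
  moreover have "inj T"
    unfolding linear_injective_0[OF \<open>linear T\<close>]
  proof (intro allI impI, clarify)
    fix a b :: real and y :: "real^2"
    assume T0: "T (a, b, y) = 0"
    then have "L (a *\<^sub>R \<xi> + b *\<^sub>R z + h y) = 0"
      by (simp add: T_def linear_0[OF L(1)])
    then have "y = 0"
      using h(2) by (simp add: linear_add[OF L(1)] linear_scale[OF L(1)] \<xi> z pointfree_idE)
    then have *: "a *\<^sub>R \<xi> + b *\<^sub>R z = 0"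
      using T0 by (simp add: T_def linear_0[OF h(1)])
    have "b = 0"
    proof (rule ccontr)
      assume "b \<noteq> 0"
      from * have "b *\<^sub>R z = - (a *\<^sub>R \<xi>)" by (simp add: add_eq_0_iff)
      then have "(1 / b) *\<^sub>R (b *\<^sub>R z) = (1 / b) *\<^sub>R (- (a *\<^sub>R \<xi>))" by simp
      then have "z = (- a / b) *\<^sub>R \<xi>" using \<open>b \<noteq> 0\<close> by simp
      then show False using nz by blast
    qed
    then have "a = 0" using * \<xi>(2) by simp
    then show "(a, b, y) = 0" using \<open>b = 0\<close> \<open>y = 0\<close> by (simp add: zero_prod_def)
  qed
  ultimately have "dim (range T) = DIM(real \<times> real \<times> (real^2))"
    by (simp add: dim_image_eq)
  moreover have "dim (range T) \<le> DIM(real^3)"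
    by (rule dim_subset_UNIV)
  ultimately show False
    by simp
qed

section \<open>The curvature of a warped product metric\<close>

lemma matrix_inv_eqI:
  fixes M N :: "real^'n^'n"
  assumes "M ** N = mat 1" "N ** M = mat 1"
  shows "matrix_inv M = N"
proof -
  have "M ** matrix_inv M = mat 1 \<and> matrix_inv M ** M = mat 1"
    unfolding matrix_inv_def by (rule someI[of _ N]) (simp add: assms)
  then show ?thesis
    by (metis assms(2) matrix_mul_assoc matrix_mul_lid matrix_mul_rid)
qed

lemma partial_first_coordinate:
  fixes x :: "real^2"
  assumes "open W" "x \<in> W" "\<And>y. y \<in> W \<Longrightarrow> F y = h (y $ 1)"
    and h: "(h has_real_derivative D) (at (x $ 1))"
  shows "partial 1 F x = D" and "partial 2 F x = 0"
proof -
  have "((\<lambda>y::real^2. h (y $ 1)) has_derivative (\<lambda>v. D * (v $ 1))) (at x)"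
    using h unfolding has_field_derivative_def
    by (rule has_derivative_compose[rotated]) (auto intro!: derivative_eq_intros bounded_linear_imp_has_derivative bounded_linear_vec_nth)
  moreover have "eventually (\<lambda>y. F y = h (y $ 1)) (nhds x)"
    using eventually_nhds_in_open[OF assms(1,2)] by (rule eventually_mono) (rule assms(3))
  ultimately have "(F has_derivative (\<lambda>v. D * (v $ 1))) (at x)"
    by (simp add: has_derivative_cong_nhds)
  from frechet_derivative_at[OF this, symmetric] show "partial 1 F x = D" "partial 2 F x = 0"
    by (simp_all add: partial_def axis_def)
qed

text \<open>For \<open>E = \<omega>\<^sup>2\<close> the right-hand side is -\<omega>''/\<omega>. It
  is stated in terms of \<open>E\<close> because the squared length of X is directly seen to be
  smooth, without a square root. The coefficients are prescribed on a whole neighbourhood since they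
  get differentiated twice.\<close>

lemma planar_gauss_curvature_warped:
  fixes E E' :: "real \<Rightarrow> real" and W :: "(real^2) set"
  assumes W: "open W" "x \<in> W"
    and G: "\<And>y. y \<in> W \<Longrightarrow> G 1 1 y = 1" "\<And>y. y \<in> W \<Longrightarrow> G 1 2 y = 0"
      "\<And>y. y \<in> W \<Longrightarrow> G 2 1 y = 0" "\<And>y. y \<in> W \<Longrightarrow> G 2 2 y = E (y $ 1)"
    and E: "\<And>y. y \<in> W \<Longrightarrow> E (y $ 1) > 0"
      "\<And>y. y \<in> W \<Longrightarrow> (E has_real_derivative E' (y $ 1)) (at (y $ 1))"
      "(E' has_real_derivative E'') (at (x $ 1))"
  shows "planar_gauss_curvature G x = (E' (x $ 1))\<^sup>2 / (4 * (E (x $ 1))\<^sup>2) - E'' / (2 * E (x $ 1))"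
proof -
  have inv: "matrix_inv (\<chi> m n. G m n y) $ 1 $ 1 = 1" "matrix_inv (\<chi> m n. G m n y) $ 1 $ 2 = 0"
      "matrix_inv (\<chi> m n. G m n y) $ 2 $ 1 = 0" "matrix_inv (\<chi> m n. G m n y) $ 2 $ 2 = 1 / E (y $ 1)"
    if "y \<in> W" for y
  proof -
    define N :: "real^2^2" where "N = vector [vector [1, 0], vector [0, 1 / E (y $ 1)]]"
    have "matrix_inv (\<chi> m n. G m n y) = N"
      using G[OF that] E(1)[OF that]
      by (intro matrix_inv_eqI)
        (auto simp: N_def matrix_matrix_mult_def mat_def vec_eq_iff forall_2 sum_2)
    then show "matrix_inv (\<chi> m n. G m n y) $ 1 $ 1 = 1" "matrix_inv (\<chi> m n. G m n y) $ 1 $ 2 = 0"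
      "matrix_inv (\<chi> m n. G m n y) $ 2 $ 1 = 0" "matrix_inv (\<chi> m n. G m n y) $ 2 $ 2 = 1 / E (y $ 1)"
      by (simp_all add: N_def)
  qed
  have pc: "partial 1 F y = 0" "partial 2 F y = 0" if "y \<in> W" "\<And>z. z \<in> W \<Longrightarrow> F z = c" for F c y
    using partial_first_coordinate[OF W(1) that(1), of F "\<lambda>_. c" 0] that(2) by auto
  have p: "partial 1 (G 2 2) y = E' (y $ 1)" "partial 2 (G 2 2) y = 0"
      "partial i (G 1 1) y = 0" "partial i (G 1 2) y = 0" "partial i (G 2 1) y = 0"
    if "y \<in> W" for i y
    using partial_first_coordinate[OF W(1) that G(4) E(2)[OF that]] pc[OF that G(1)] pc[OF that G(2)] pc[OF that G(3)]
      exhaust_2[of i] by auto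
  have ch: "christoffel G 1 1 1 y = 0" "christoffel G 1 1 2 y = 0" "christoffel G 1 2 1 y = 0"
      "christoffel G 1 2 2 y = - E' (y $ 1) / 2" "christoffel G 2 1 2 y = E' (y $ 1) / (2 * E (y $ 1))"
      "christoffel G 2 2 2 y = 0" if "y \<in> W" for y
    using p[OF that] inv[OF that] by (simp_all add: christoffel_def sum_2)
  have "((\<lambda>u. - E' u / 2) has_real_derivative - E'' / 2) (at (x $ 1))"
    using E(3) by (auto intro!: derivative_eq_intros)
  from partial_first_coordinate(1)[OF W ch(4) this]
  have d1: "partial 1 (christoffel G 1 2 2) x = - E'' / 2" by simp
  have d2: "partial 2 (christoffel G 1 1 2) x = 0"
    by (rule pc(2)[OF W(2) ch(2)])
  \<comment> \<open>Of the two summands in the curvature only the one with upper index 1 survives;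
    the other is multiplied by \<open>G 2 1 x = 0\<close>.\<close>
  have "curvature_component G 1 1 2 2 x = - E'' / 2 + E' (x $ 1) / 2 * (E' (x $ 1) / (2 * E (x $ 1)))"
    unfolding curvature_component_def sum_2 d1 d2 by (simp add: ch[OF W(2)])
  then show ?thesis
    using G[OF W(2)] E(1)[OF W(2)]
    by (simp add: planar_gauss_curvature_def sum_2 det_2 field_simps power2_eq_square)
qed

section \<open>Invariant surfaces in adapted coordinates\<close>

lemma coord_vec_self:
  assumes A: "smooth_structure A" and c: "c \<in> A" "p \<in> fst c"
  shows "coord_vec A c p v c = v"
proof -
  have ic: "is_chart c"
    using A c(1) by (rule smooth_structure_is_chart)
  have "eventually (\<lambda>x. x \<in> snd c ` fst c) (nhds (snd c p))"
    using open_chart_range[OF ic] c(2) by (auto intro: eventually_nhds_in_open)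
  then have "eventually (\<lambda>x. (snd c \<circ> chart_inv c) x = id x) (nhds (snd c p))"
    by (rule eventually_mono) (simp add: chart_inv_right[OF ic])
  then show ?thesis
    using c by (simp add: coord_vec_def frechet_derivative_cong_nhds)
qed

lemma frechet_derivative_line:
  "(\<lambda>s::real. x + s *\<^sub>R e) differentiable (at t)"
  "frechet_derivative (\<lambda>s::real. x + s *\<^sub>R e) (at t) 1 = e"
proof -
  have D: "((\<lambda>s::real. x + s *\<^sub>R e) has_derivative (\<lambda>s. s *\<^sub>R e)) (at t)"
    by (auto intro!: derivative_eq_intros)
  then show "(\<lambda>s::real. x + s *\<^sub>R e) differentiable (at t)"
    by (auto simp: differentiable_def)
  show "frechet_derivative (\<lambda>s::real. x + s *\<^sub>R e) (at t) 1 = e"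
    by (simp flip: frechet_derivative_at[OF D])
qed

lemma pushforward_const:
  "pushforward A (\<lambda>_. p) x v = (\<lambda>_. 0)"
  by (auto simp: pushforward_def o_def)

text \<open>Everything about the ambient manifold, the surface and the profile curve. The curvature
  and the loxodrome appear as hypotheses of the individual lemmas, so the geometry of the
  parametrization is developed for any invariant surface.\<close>

locale adapted_surface =
  fixes A :: "('a::{t2_space, second_countable_topology}, real^3) chart set"
    and g :: "('a, real^3) metric"
    and X :: "'a \<Rightarrow> ('a, real^3) tvec"
    and \<phi> :: "real \<Rightarrow> 'a \<Rightarrow> 'a"
    and Q :: "('q::{t2_space, second_countable_topology}, real^2) chart set"
    and gq :: "('q, real^2) metric"
    and \<pi> :: "'a \<Rightarrow> 'q"
    and B :: "('m::{t2_space, second_countable_topology}, real^2) chart set"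
    and f :: "'m \<Rightarrow> 'a"
    and act :: "('a \<Rightarrow> 'a) \<Rightarrow> 'm \<Rightarrow> 'm"
    and I :: "real set"
    and \<gamma>q :: "real \<Rightarrow> 'q" and \<gamma> :: "real \<Rightarrow> 'a" and \<gamma>M :: "real \<Rightarrow> 'm"
    and \<omega> :: "real \<Rightarrow> real"
    and \<Psi> :: "real \<Rightarrow> real \<Rightarrow> 'm"
  assumes A: "smooth_structure A" and g: "riemannian_metric A g"
    and killing: "killing_field A g X" and flow: "isometry_flow A g X \<phi>"
    and orbit_space: "riemannian_orbit_space A g (range \<phi>) Q gq \<pi>"
    and surface: "invariant_surface A \<phi> B f act"
    and I: "open_interval I" and \<gamma>q: "unit_speed Q gq I \<gamma>q"
    and \<gamma>: "smooth_curve A I \<gamma>" "\<And>u. u \<in> I \<Longrightarrow> \<gamma> u \<in> regular_part (range \<phi>) \<and> \<pi> (\<gamma> u) = \<gamma>q u"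
    and horizontal: "\<And>u. u \<in> I \<Longrightarrow> g (\<gamma> u) (velocity A \<gamma> u) (X (\<gamma> u)) = 0"
    and \<gamma>M: "\<And>u. u \<in> I \<Longrightarrow> f (\<gamma>M u) = \<gamma> u"
    and \<Psi>_def: "\<And>u v. \<Psi> u v = act (\<phi> v) (\<gamma>M u)"
    and param: "local_parametrization B {x. x $ 1 \<in> I} (\<lambda>x. \<Psi> (x $ 1) (x $ 2))"
    and \<omega>_def: "\<And>u. \<omega> u = tangent_norm g (\<gamma> u) (X (\<gamma> u))"
begin

abbreviation "param_map \<equiv> \<lambda>x::real^2. \<Psi> (x $ 1) (x $ 2)"
abbreviation "induced_metric \<equiv> pullback_metric B A g f"

lemma flow_action: "smooth_real_action A \<phi>"
  using flow by (simp add: isometry_flow_def)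

lemma surface_action: "smooth_real_action B (\<lambda>t. act (\<phi> t))"
  and B: "smooth_structure B"
  and immersion: "smooth_immersion B A f"
  using surface by (simp_all add: invariant_surface_def)

lemma open_I: "open I" and interval_I: "is_interval I"
  using I by (auto simp: open_interval_def)

lemma f_equivariant: "f (act (\<phi> t) p) = \<phi> t (f p)"
  using surface by (simp add: invariant_surface_def)

lemma f_\<Psi>: "u \<in> I \<Longrightarrow> f (\<Psi> u v) = \<phi> v (\<gamma> u)"
  by (simp add: \<Psi>_def f_equivariant \<gamma>M)

lemma act_\<Psi>: "act (\<phi> t) (\<Psi> u v) = \<Psi> u (t + v)"
  using smooth_real_action_add[OF B surface_action] by (simp add: \<Psi>_def)

lemma \<Psi>_0: "\<Psi> u 0 = \<gamma>M u"
  using smooth_real_action_0[OF B surface_action] by (simp add: \<Psi>_def)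

text \<open>A chart whose coordinates are the pair (u, v): its inverse is \<open>param_map\<close>
  on \<open>W\<close>. The set \<open>W\<close> selects one sheet of the parametrization, as
  \<open>param_map\<close> may reach the same points from other parameters as well.\<close>

definition adapted_chart :: "('m, real^2) chart \<Rightarrow> (real^2) set \<Rightarrow> bool" where
  "adapted_chart c W \<longleftrightarrow> c \<in> B \<and> open W \<and> W \<subseteq> {x. x $ 1 \<in> I} \<and>
     fst c = param_map ` W \<and> (\<forall>y\<in>W. snd c (param_map y) = y)"

lemma adapted_chartD:
  assumes "adapted_chart c W"
  shows "c \<in> B" "open W" "W \<subseteq> {x. x $ 1 \<in> I}" "fst c = param_map ` W" "snd c ` fst c = W"
    and "\<And>y. y \<in> W \<Longrightarrow> snd c (param_map y) = y" and "\<And>y. y \<in> W \<Longrightarrow> chart_inv c y = param_map y"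
proof -
  show c: "c \<in> B" "open W" "W \<subseteq> {x. x $ 1 \<in> I}" "fst c = param_map ` W"
    using assms by (simp_all add: adapted_chart_def)
  show s: "snd c (param_map y) = y" if "y \<in> W" for y
    using assms that by (simp add: adapted_chart_def)
  show "snd c ` fst c = W"
    using c(4) s by (simp add: image_image)
  show "chart_inv c y = param_map y" if "y \<in> W" for y
    using chart_inv_left[OF smooth_structure_is_chart[OF B c(1)], of "param_map y"] s[OF that] c(4) that
    by simp
qed

lemma adapted_chart_exists:
  assumes "x $ 1 \<in> I"
  obtains c W where "adapted_chart c W" "x \<in> W"
proof -
  obtain W where W: "open W" "x \<in> W" "W \<subseteq> {x. x $ 1 \<in> I}" "inj_on param_map W"
      "(param_map ` W, inv_into W param_map) \<in> B"
    using assms param unfolding local_parametrization_def by blast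
  have "adapted_chart (param_map ` W, inv_into W param_map) W"
    using W inv_into_f_f[OF W(4)] by (simp add: adapted_chart_def)
  then show thesis using W(2) that by blast
qed

lemma
  assumes c: "adapted_chart c W" and x: "x \<in> W"
  shows differentiable_param_map_chart: "differentiable_into B param_map x"
    and coord_vec_param_map: "coord_vec B c (param_map x) v = pushforward B param_map x v"
proof -
  have ev: "eventually (\<lambda>y. chart_inv c y = param_map y) (nhds x)"
    using adapted_chartD(2,7)[OF c] x by (auto simp: eventually_nhds)
  have "x \<in> snd c ` fst c" using adapted_chartD(5)[OF c] x by simp
  note d = differentiable_into_chart_inv[OF B adapted_chartD(1)[OF c] this]
  show "differentiable_into B param_map x"
    using d(1) by (simp only: differentiable_into_cong(1)[OF ev])
  show "coord_vec B c (param_map x) v = pushforward B param_map x v"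
    using d(2)[of v] unfolding differentiable_into_cong(2)[OF ev] adapted_chartD(7)[OF c x] .
qed

lemma differentiable_param_map: "x $ 1 \<in> I \<Longrightarrow> differentiable_into B param_map x"
  using adapted_chart_exists differentiable_param_map_chart by metis

section \<open>The coordinate vectors of the parametrization in the ambient manifold\<close>

lemma differentiable_f: "differentiable_between B A f p"
  using immersion smooth_map_on_differentiable_between[of B A UNIV f p] by (simp add: smooth_immersion_def)

lemma differentiable_f_param:
  assumes "x $ 1 \<in> I"
  shows "differentiable_into A (\<lambda>y. f (param_map y)) x"
    and "differential B A f (param_map x) (pushforward B param_map x v)
      = pushforward A (\<lambda>y. f (param_map y)) x v"
  using differential_pushforward[OF B differentiable_f differentiable_param_map[OF assms]] by blast+

text \<open>The v-lines are orbits: moving along the second axis by \<open>s\<close> amounts to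
  applying \<open>\<phi> s\<close> to the image point, for every \<open>s\<close>.\<close>

lemma push_axis_2:
  assumes "x $ 1 \<in> I"
  shows "pushforward A (\<lambda>y. f (param_map y)) x (axis 2 1) = X (f (param_map x))"
proof -
  have "pushforward A (\<lambda>y. f (param_map y)) x (axis 2 1)
      = pushforward A (\<lambda>s. f (param_map (x + s *\<^sub>R axis 2 1))) 0 1"
    using differentiable_into_compose(2)[of A "\<lambda>y. f (param_map y)" "\<lambda>s. x + s *\<^sub>R axis 2 1" 0 1]
      differentiable_f_param(1)[OF assms] by (simp add: frechet_derivative_line)
  also have "(\<lambda>s. f (param_map (x + s *\<^sub>R axis 2 1))) = (\<lambda>s. \<phi> s (f (param_map x)))"
    using assms by (simp add: f_\<Psi> axis_def smooth_real_action_add[OF A flow_action, symmetric] add.commute)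
  also have "pushforward A (\<lambda>s. \<phi> s (f (param_map x))) 0 1 = X (f (param_map x))"
    using isometry_flow_field(1)[OF A flow, where t = 0] smooth_real_action_0[OF A flow_action] by metis
  finally show ?thesis .
qed

lemma differentiable_\<gamma>: "u \<in> I \<Longrightarrow> differentiable_into A \<gamma> u"
  using smooth_curve_differentiable_into[OF \<gamma>(1) open_I] .

text \<open>The u-line at height v is the image of \<gamma> under \<open>\<phi> v\<close>. In
  contrast to the v-direction this is available near the point only, where the first coordinate
  stays in \<open>I\<close>.\<close>

lemma push_axis_1:
  assumes "x $ 1 \<in> I"
  shows "pushforward A (\<lambda>y. f (param_map y)) x (axis 1 1)
    = differential A A (\<phi> (x $ 2)) (\<gamma> (x $ 1)) (velocity A \<gamma> (x $ 1))"
proof -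
  let ?k = "\<lambda>s::real. x $ 1 + s *\<^sub>R 1"
  have d: "differentiable_into A (\<lambda>s. \<gamma> (?k s)) 0"
    and p: "pushforward A (\<lambda>s. \<gamma> (?k s)) 0 1 = velocity A \<gamma> (x $ 1)"
    using differentiable_into_compose[of A \<gamma> ?k 0] frechet_derivative_line[of "x $ 1" 1 0]
      differentiable_\<gamma>[OF assms] velocity_eq_pushforward[OF differentiable_\<gamma>[OF assms]] by simp_all
  have "isCont ?k 0" by (intro continuous_intros)
  then have "eventually (\<lambda>s. ?k s \<in> I) (nhds 0)"
    using open_I assms by (intro eventually_nhds_isCont) simp_all
  then have ev: "eventually (\<lambda>s. f (param_map (x + s *\<^sub>R axis 1 1)) = \<phi> (x $ 2) (\<gamma> (?k s))) (nhds 0)"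
    by (rule eventually_mono) (simp add: f_\<Psi> axis_def)
  have "pushforward A (\<lambda>y. f (param_map y)) x (axis 1 1)
      = pushforward A (\<lambda>s. f (param_map (x + s *\<^sub>R axis 1 1))) 0 1"
    using differentiable_into_compose(2)[of A "\<lambda>y. f (param_map y)" "\<lambda>s. x + s *\<^sub>R axis 1 1" 0 1]
      differentiable_f_param(1)[OF assms] by (simp add: frechet_derivative_line)
  also have "\<dots> = pushforward A (\<lambda>s. \<phi> (x $ 2) (\<gamma> (?k s))) 0 1"
    unfolding differentiable_into_cong(2)[OF ev] ..
  also have "\<dots> = differential A A (\<phi> (x $ 2)) (\<gamma> (?k 0)) (pushforward A (\<lambda>s. \<gamma> (?k s)) 0 1)"
    using differential_pushforward(2)[OF A smooth_real_action_differentiable(1)[OF A flow_action] d] by metis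
  finally show ?thesis using p by simp
qed

text \<open>X is the image of the second coordinate vector of the surface under the differential of
  \<open>f\<close>. If it vanished, that coordinate vector and the zero vector would have the same
  image, against injectivity of the differential of an immersion.\<close>

lemma X_nonzero:
  assumes "u \<in> I"
  shows "X (\<gamma> u) \<noteq> (\<lambda>_. 0)"
proof
  assume X0: "X (\<gamma> u) = (\<lambda>_. 0)"
  define x :: "real^2" where "x = vector [u, 0]"
  have x: "x $ 1 \<in> I" "f (param_map x) = \<gamma> u"
    using assms smooth_real_action_0[OF A flow_action] by (simp_all add: x_def f_\<Psi>)
  obtain c W where c: "adapted_chart c W" "x \<in> W"
    using adapted_chart_exists[OF x(1)] .
  note coord = coord_vec_param_map[OF c]
  have "param_map x \<in> fst c"
    using c(2) adapted_chartD(4)[OF c(1)] by blast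
  then have self: "pushforward B param_map x v c = v" for v
    using coord_vec_self[OF B adapted_chartD(1)[OF c(1)], of "param_map x" v] coord[of v] by simp
  have "pushforward A (\<lambda>y. f (param_map y)) x 0 = (\<lambda>_. 0)"
    using linear_0[OF linear_pushforward[OF differentiable_f_param(1)[OF x(1)]]] by auto
  then have "differential B A f (param_map x) (pushforward B param_map x 0)
      = differential B A f (param_map x) (pushforward B param_map x (axis 2 1))"
    using push_axis_2[OF x(1)] X0 x(2) by (simp add: differentiable_f_param(2)[OF x(1)])
  moreover have "inj_on (differential B A f (param_map x)) (tangent_space B (param_map x))"
    using immersion by (simp add: smooth_immersion_def)
  ultimately have "pushforward B param_map x 0 = pushforward B param_map x (axis 2 1)"
    using pushforward_in_tangent_space[OF B differentiable_param_map[OF x(1)]] by (auto dest: inj_onD)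
  from fun_cong[OF this, of c] have "(0::real^2) = axis 2 1"
    unfolding self .
  then show False
    by (metis axis_eq_0_iff zero_neq_one)
qed

lemma g_X_pos: "u \<in> I \<Longrightarrow> g (\<gamma> u) (X (\<gamma> u)) (X (\<gamma> u)) > 0"
  using metric_pos[OF A g isometry_flow_field(2)[OF A flow]] X_nonzero by blast

lemma \<omega>_pos: "u \<in> I \<Longrightarrow> \<omega> u > 0"
  and \<omega>_square: "u \<in> I \<Longrightarrow> (\<omega> u)\<^sup>2 = g (\<gamma> u) (X (\<gamma> u)) (X (\<gamma> u))"
  using g_X_pos by (simp_all add: \<omega>_def tangent_norm_def less_imp_le)

section \<open>The orbit projection and the speed of the horizontal lift\<close>

lemma \<pi>_differentiable: "p \<in> regular_part (range \<phi>) \<Longrightarrow> differentiable_between A Q \<pi> p"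
  using orbit_space smooth_map_on_differentiable_between by (auto simp: riemannian_orbit_space_def)

lemma orbit_flow: "orbit_of (range \<phi>) (\<phi> s p) = orbit_of (range \<phi>) p"
proof -
  have "\<phi> t (\<phi> s p) = \<phi> (t + s) p" "\<phi> t p = \<phi> (t - s) (\<phi> s p)" for t
    using smooth_real_action_add[OF A flow_action, of t s p] smooth_real_action_add[OF A flow_action, of "t - s" s p]
    by simp_all
  then have "(\<exists>t. q = \<phi> t (\<phi> s p)) \<longleftrightarrow> (\<exists>t. q = \<phi> t p)" for q
    by metis
  then show ?thesis
    by (simp add: orbit_of_def image_image set_eq_iff image_iff)
qed

text \<open>The projection is constant along an orbit, and for small times the orbit curve stays in
  the open regular part, where fibres and orbits agree.\<close>

lemma differential_\<pi>_X:
  assumes "p \<in> regular_part (range \<phi>)"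
  shows "differential A Q \<pi> p (X p) = (\<lambda>_. 0)"
proof -
  note d = smooth_real_action_differentiable(2)[OF A flow_action, of p 0]
  have p0: "\<phi> 0 p = p"
    by (rule smooth_real_action_0[OF A flow_action])
  have "open (regular_part (range \<phi>))"
    using orbit_space by (simp add: riemannian_orbit_space_def)
  then have "eventually (\<lambda>s. \<phi> s p \<in> regular_part (range \<phi>)) (nhds 0)"
    using d assms p0 by (intro eventually_nhds_isCont) (auto simp: differentiable_into_def)
  then have ev: "eventually (\<lambda>s. \<pi> (\<phi> s p) = \<pi> p) (nhds 0)"
    by (rule eventually_mono) (use orbit_space assms orbit_flow in \<open>auto simp: riemannian_orbit_space_def\<close>)
  have "X p = pushforward A (\<lambda>s. \<phi> s p) 0 1"
    using isometry_flow_field(1)[OF A flow, where t = 0 and p = p] p0 by simp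
  then have "differential A Q \<pi> p (X p) = pushforward Q (\<lambda>s. \<pi> (\<phi> s p)) 0 1"
    using differential_pushforward(2)[OF A _ d, where f = \<pi> and B = Q and v = 1] \<pi>_differentiable[OF assms] p0 by simp
  also have "\<dots> = (\<lambda>_. 0)"
    by (simp add: differentiable_into_cong(2)[OF ev] pushforward_const)
  finally show ?thesis .
qed

text \<open>The differential of \<pi> maps a 3-dimensional space onto a plane, so its kernel is a
  line, and X lies on it. Hence orthogonality to X, the horizontality assumed for \<gamma>, is
  orthogonality to all vertical vectors, the horizontality used for Riemannian submersions.\<close>

lemma vertical_vector:
  assumes p: "p \<in> regular_part (range \<phi>)" and X: "X p \<noteq> (\<lambda>_. 0)"
    and Z: "Z \<in> tangent_space A p" "differential A Q \<pi> p Z = (\<lambda>_. 0)"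
    and V: "V \<in> tangent_space A p" "g p V (X p) = 0"
  shows "g p V Z = 0"
proof -
  have Q: "smooth_structure Q"
    using orbit_space by (simp add: riemannian_orbit_space_def)
  obtain c where c: "c \<in> A" "p \<in> fst c"
    using smooth_structure_covers[OF A] by blast
  obtain d where d: "d \<in> Q" "\<pi> p \<in> fst d"
    using smooth_structure_covers[OF Q] by blast
  define x where "x = snd c p"
  have x: "x \<in> snd c ` fst c" "chart_inv c x = p"
    using chart_inv_left[OF smooth_structure_is_chart[OF A c(1)] c(2)] c(2) by (simp_all add: x_def)
  note ci = differentiable_into_chart_inv[OF A c(1) x(1)]
  have rep: "W = pushforward A (chart_inv c) x (W c)" if "W \<in> tangent_space A p" for W
    using tangent_space_coord_vec[OF A that c] ci(2) x(2) by metis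
  let ?L = "\<lambda>w. pushforward Q (\<lambda>y. \<pi> (chart_inv c y)) x w d"
  have push: "differentiable_into Q (\<lambda>y. \<pi> (chart_inv c y)) x"
    "differential A Q \<pi> p (pushforward A (chart_inv c) x w) = pushforward Q (\<lambda>y. \<pi> (chart_inv c y)) x w" for w
    using differential_pushforward[OF A _ ci(1), of Q \<pi>] \<pi>_differentiable[OF p] x(2) by auto
  have L: "?L (W c) = differential A Q \<pi> p W d" if "W \<in> tangent_space A p" for W
    using push(2)[of "W c"] rep[OF that] by simp
  have "linear ?L"
    by (rule linear_pushforward[OF push(1)])
  moreover have "surj ?L"
  proof (rule surjI)
    fix y :: "real^2"
    have "differential A Q \<pi> p ` tangent_space A p = tangent_space Q (\<pi> p)"
      using orbit_space p by (simp add: riemannian_orbit_space_def)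
    moreover have "coord_vec Q d (\<pi> p) y \<in> tangent_space Q (\<pi> p)"
      using d unfolding tangent_space_def by blast
    ultimately have ex: "\<exists>W. W \<in> tangent_space A p \<and> differential A Q \<pi> p W = coord_vec Q d (\<pi> p) y"
      by (metis (no_types, lifting) imageE)
    let ?W = "\<lambda>y. SOME W. W \<in> tangent_space A p \<and> differential A Q \<pi> p W = coord_vec Q d (\<pi> p) y"
    show "?L ((?W y) c) = y"
      using someI_ex[OF ex] L[of "?W y"] coord_vec_self[OF Q d] by simp
  qed
  moreover have X': "X p \<in> tangent_space A p"
    by (rule isometry_flow_field(2)[OF A flow])
  moreover have "?L (X p c) = 0" "?L (Z c) = 0"
    using L[OF X'] L[OF Z(1)] Z(2) differential_\<pi>_X[OF p] by simp_all
  moreover have "X p c \<noteq> 0"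
  proof
    assume "X p c = 0"
    then have "X p = pushforward A (chart_inv c) x 0"
      using rep[OF X'] by simp
    then show False
      using X linear_0[OF linear_pushforward[OF ci(1)]] by auto
  qed
  ultimately obtain k where k: "Z c = k *\<^sub>R X p c"
    using linear_kernel_codim_one[of ?L "X p c" "Z c"] by blast
  let ?b = "\<lambda>v w. g (chart_inv c x) (pushforward A (chart_inv c) x v) (pushforward A (chart_inv c) x w)"
  have "g p V Z = ?b (V c) (k *\<^sub>R X p c)"
    using rep[OF V(1)] rep[OF Z(1)] k x(2) by simp
  also have "\<dots> = k * ?b (V c) (X p c)"
    using bilinear_rmul[OF bilinear_pushforward_metric(1)[OF A g ci(1)]] by simp
  also have "?b (V c) (X p c) = 0"
    using rep[OF V(1)] rep[OF X'] V(2) x(2) by simp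
  finally show ?thesis by simp
qed

text \<open>A Riemannian submersion preserves lengths of horizontal vectors, and the velocity of
  \<gamma> is horizontal and projects to that of the unit speed curve
  \<open>\<gamma>q\<close>.\<close>

lemma \<gamma>_unit_speed:
  assumes "u \<in> I"
  shows "g (\<gamma> u) (velocity A \<gamma> u) (velocity A \<gamma> u) = 1"
proof -
  let ?p = "\<gamma> u" and ?V = "velocity A \<gamma> u"
  have p: "?p \<in> regular_part (range \<phi>)" "\<pi> ?p = \<gamma>q u"
    using \<gamma>(2)[OF assms] by simp_all
  note d\<gamma> = differentiable_\<gamma>[OF assms]
  have V: "?V \<in> tangent_space A ?p"
    using pushforward_in_tangent_space[OF A d\<gamma>] velocity_eq_pushforward[OF d\<gamma>] by metis
  have ev: "eventually (\<lambda>s. \<pi> (\<gamma> s) = \<gamma>q s) (nhds u)"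
    using eventually_nhds_in_open[OF open_I assms] by (rule eventually_mono) (simp add: \<gamma>(2))
  have "differential A Q \<pi> ?p ?V = pushforward Q (\<lambda>s. \<pi> (\<gamma> s)) u 1"
    using differential_pushforward(2)[OF A \<pi>_differentiable[OF p(1)] d\<gamma>] velocity_eq_pushforward[OF d\<gamma>] by metis
  also have "\<dots> = pushforward Q \<gamma>q u 1"
    by (simp add: differentiable_into_cong(2)[OF ev])
  also have "\<dots> = velocity Q \<gamma>q u"
    using \<gamma>q velocity_eq_pushforward[OF smooth_curve_differentiable_into[OF _ open_I assms]]
    by (metis unit_speed_def)
  finally have "pullback_metric A Q gq \<pi> ?p ?V ?V = gq (\<gamma>q u) (velocity Q \<gamma>q u) (velocity Q \<gamma>q u)"
    by (simp add: pullback_metric_def p)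
  also have "\<dots> = 1"
    using \<gamma>q assms by (simp add: unit_speed_def tangent_norm_def)
  finally have 1: "pullback_metric A Q gq \<pi> ?p ?V ?V = 1" .
  have "\<forall>Z\<in>{Z \<in> tangent_space A ?p. differential A Q \<pi> ?p Z = (\<lambda>_. 0)}. g ?p ?V Z = 0"
    using vertical_vector[OF p(1) X_nonzero[OF assms] _ _ V horizontal[OF assms]] by blast
  with V orbit_space p(1) have "pullback_metric A Q gq \<pi> ?p ?V ?V = g ?p ?V ?V"
    by (simp add: riemannian_orbit_space_def Let_def)
  with 1 show ?thesis by simp
qed

text \<open>Both coordinate vectors at (u, v) are images under the isometry \<open>\<phi> v\<close>
  of vectors at \<open>\<gamma> u\<close>, so the coefficients depend on u alone: unit speed,
  horizontality and the length of X give 1, 0 and \<open>\<omega>\<^sup>2\<close>.\<close>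

lemma first_fundamental_form:
  assumes "x $ 1 \<in> I"
  shows "g (f (param_map x)) (pushforward A (\<lambda>y. f (param_map y)) x v) (pushforward A (\<lambda>y. f (param_map y)) x w)
    = v $ 1 * w $ 1 + (\<omega> (x $ 1))\<^sup>2 * (v $ 2 * w $ 2)" (is "?b v w = _")
proof -
  note d = differentiable_f_param(1)[OF assms]
  note b = bilinear_pushforward_metric(1)[OF A g d]
  let ?u = "x $ 1" and ?t = "x $ 2"
  have F: "f (param_map x) = \<phi> ?t (\<gamma> ?u)"
    using assms by (simp add: f_\<Psi>)
  have X: "differential A A (\<phi> ?t) (\<gamma> ?u) (X (\<gamma> ?u)) = X (f (param_map x))"
    using isometry_flow_field(3)[OF A flow] F by simp
  have V: "velocity A \<gamma> ?u \<in> tangent_space A (\<gamma> ?u)"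
    using pushforward_in_tangent_space[OF A differentiable_\<gamma>[OF assms]]
      velocity_eq_pushforward[OF differentiable_\<gamma>[OF assms]] by metis
  note X' = isometry_flow_field(2)[OF A flow, of "\<gamma> ?u"]
  have pres: "g (f (param_map x)) (differential A A (\<phi> ?t) (\<gamma> ?u) Y) (differential A A (\<phi> ?t) (\<gamma> ?u) Z) = g (\<gamma> ?u) Y Z"
    if "Y \<in> tangent_space A (\<gamma> ?u)" "Z \<in> tangent_space A (\<gamma> ?u)" for Y Z
    using flow that F by (simp add: isometry_flow_def preserves_metric_def pullback_metric_def)
  have e11: "?b (axis 1 1) (axis 1 1) = 1"
    unfolding push_axis_1[OF assms] pres[OF V V] by (rule \<gamma>_unit_speed[OF assms])
  have e12: "?b (axis 1 1) (axis 2 1) = 0"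
    unfolding push_axis_1[OF assms] push_axis_2[OF assms] X[symmetric] pres[OF V X'] by (rule horizontal[OF assms])
  then have e21: "?b (axis 2 1) (axis 1 1) = 0"
    using bilinear_pushforward_metric(2)[OF A g d] by metis
  have e22: "?b (axis 2 1) (axis 2 1) = (\<omega> ?u)\<^sup>2"
    unfolding push_axis_2[OF assms] X[symmetric] pres[OF X' X'] by (rule \<omega>_square[OF assms, symmetric])
  have expand: "v = v $ 1 *\<^sub>R axis 1 1 + v $ 2 *\<^sub>R axis 2 1" for v :: "real^2"
    by (simp add: vec_eq_iff forall_2 axis_def)
  have "?b v w = ?b (v $ 1 *\<^sub>R axis 1 1 + v $ 2 *\<^sub>R axis 2 1) (w $ 1 *\<^sub>R axis 1 1 + w $ 2 *\<^sub>R axis 2 1)"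
    using expand[of v] expand[of w] by simp
  also have "\<dots> = v $ 1 * w $ 1 + (\<omega> (x $ 1))\<^sup>2 * (v $ 2 * w $ 2)"
    unfolding bilinear_ladd[OF b] bilinear_radd[OF b] bilinear_lmul[OF b] bilinear_rmul[OF b] e11 e12 e21 e22
    by (simp add: algebra_simps)
  finally show ?thesis .
qed

end

section \<open>The differential equation of the profile\<close>

text \<open>The metric in a chart is known to be smooth for fixed arguments only. The expansion
  turns g(X, X), whose arguments move with the point, into a sum of products of smooth
  functions.\<close>

lemma bilinear_Basis_expansion:
  fixes b :: "'e::euclidean_space \<Rightarrow> 'e \<Rightarrow> real"
  assumes "bilinear b"
  shows "b v v = (\<Sum>i\<in>Basis. \<Sum>j\<in>Basis. (v \<bullet> i) *\<^sub>R (v \<bullet> j) *\<^sub>R b i j)"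
proof -
  have "b v v = b (\<Sum>i\<in>Basis. (v \<bullet> i) *\<^sub>R i) (\<Sum>j\<in>Basis. (v \<bullet> j) *\<^sub>R j)"
    by (simp add: euclidean_representation)
  also have "\<dots> = (\<Sum>i\<in>Basis. \<Sum>j\<in>Basis. (v \<bullet> i) *\<^sub>R (v \<bullet> j) *\<^sub>R b i j)"
    unfolding bilinear_sum[OF assms] sum.cartesian_product
    by (simp add: bilinear_lmul[OF assms] bilinear_rmul[OF assms] split_def mult_ac)
  finally show ?thesis .
qed

context adapted_surface
begin

lemma \<omega>_square_times_differentiable:
  assumes "u \<in> I"
  obtains U where "open U" "u \<in> U" "U \<subseteq> I" "times_differentiable_on n U (\<lambda>u. (\<omega> u)\<^sup>2)"
proof -
  obtain c where c: "c \<in> A" "\<gamma> u \<in> fst c"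
    using smooth_structure_covers[OF A] by blast
  note ic = smooth_structure_is_chart[OF A c(1)]
  define U where "U = I \<inter> \<gamma> -` fst c"
  define T where "T = snd c ` fst c"
  have "open U" and "open T"
    using \<gamma>(1) open_I open_chart_domain[OF ic] open_chart_range[OF ic]
    by (auto simp: U_def T_def smooth_curve_def intro: continuous_open_preimage)
  let ?\<xi> = "\<lambda>x. X (chart_inv c x) c" and ?m = "metric_in_chart A g c"
  let ?K = "\<lambda>x. \<Sum>i\<in>Basis. \<Sum>j\<in>Basis. (?\<xi> x \<bullet> i) *\<^sub>R (?\<xi> x \<bullet> j) *\<^sub>R ?m x i j"
  have "times_differentiable_on n T ?\<xi>"
    using killing c(1) by (simp add: killing_field_def smooth_vector_field_def smooth_on_def T_def)
  then have \<xi>: "times_differentiable_on n T (\<lambda>x. ?\<xi> x \<bullet> i)" for i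
    by (rule times_differentiable_on_bounded_linear[OF \<open>open T\<close> bounded_linear_inner_left])
  have m: "times_differentiable_on n T (\<lambda>x. ?m x i j)" for i j
    using g c(1) by (simp add: riemannian_metric_def smooth_on_def T_def)
  have K: "times_differentiable_on n T ?K"
    by (intro times_differentiable_on_sum times_differentiable_on_scaleR \<open>open T\<close> \<xi> m)
  have "times_differentiable_on n U (snd c \<circ> \<gamma>)"
    using \<gamma>(1) c(1) by (simp add: smooth_curve_def smooth_on_def U_def)
  moreover have "(snd c \<circ> \<gamma>) ` U \<subseteq> T"
    by (auto simp: U_def T_def)
  ultimately have "times_differentiable_on n U (\<lambda>u. ?K ((snd c \<circ> \<gamma>) u))"
    using times_differentiable_on_compose[OF \<open>open U\<close> \<open>open T\<close> _ _ K] by blast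
  moreover have "?K ((snd c \<circ> \<gamma>) u) = (\<omega> u)\<^sup>2" if "u \<in> U" for u
  proof -
    have u: "u \<in> I" "\<gamma> u \<in> fst c" using that by (auto simp: U_def)
    have ci: "chart_inv c (snd c (\<gamma> u)) = \<gamma> u"
      by (rule chart_inv_left[OF ic u(2)])
    have "bilinear (?m (snd c (\<gamma> u)))"
      using g c(1) u(2) by (simp add: riemannian_metric_def)
    from bilinear_Basis_expansion[OF this, of "X (\<gamma> u) c"]
    have "?K ((snd c \<circ> \<gamma>) u) = ?m (snd c (\<gamma> u)) (X (\<gamma> u) c) (X (\<gamma> u) c)"
      by (simp add: ci)
    also have "\<dots> = g (\<gamma> u) (X (\<gamma> u)) (X (\<gamma> u))"
      using tangent_space_coord_vec[OF A isometry_flow_field(2)[OF A flow] c(1) u(2)]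
        metric_coord_vec[where g = g, OF A c(1) u(2)] by metis
    finally show ?thesis using \<omega>_square[OF u(1)] by simp
  qed
  ultimately have "times_differentiable_on n U (\<lambda>u. (\<omega> u)\<^sup>2)"
    by (subst times_differentiable_on_cong[OF \<open>open U\<close>, of _ "\<lambda>u. ?K ((snd c \<circ> \<gamma>) u)"]) auto
  then show thesis
    using that[of U] \<open>open U\<close> assms c(2) by (auto simp: U_def)
qed

lemma metric_in_adapted_chart:
  assumes c: "adapted_chart c W" and y: "y \<in> W"
  shows "metric_in_chart B induced_metric c y v w = v $ 1 * w $ 1 + (\<omega> (y $ 1))\<^sup>2 * (v $ 2 * w $ 2)"
proof -
  have y1: "y $ 1 \<in> I" using adapted_chartD(3)[OF c] y by auto
  have "metric_in_chart B induced_metric c y v w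
      = induced_metric (param_map y) (coord_vec B c (param_map y) v) (coord_vec B c (param_map y) w)"
    unfolding metric_in_chart_def adapted_chartD(7)[OF c y] Let_def ..
  also have "\<dots> = v $ 1 * w $ 1 + (\<omega> (y $ 1))\<^sup>2 * (v $ 2 * w $ 2)"
    unfolding coord_vec_param_map[OF c y] pullback_metric_def differentiable_f_param(2)[OF y1]
      first_fundamental_form[OF y1] ..
  finally show ?thesis .
qed

text \<open>Equating the curvature -\<omega>''/\<omega> of the warped metric with
  \<open>- 1 / R\<^sup>2\<close>. The argument runs through \<open>?E\<close>, the square of
  \<omega>, for which differentiability is already established.\<close>

lemma \<omega>_ode:
  assumes R: "R \<noteq> 0" and K: "constant_gauss_curvature B induced_metric (- 1 / R\<^sup>2)" and u: "u \<in> I"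
  shows "(\<omega> has_real_derivative deriv \<omega> u) (at u)"
    and "(deriv \<omega> has_real_derivative \<omega> u / R\<^sup>2) (at u)"
proof -
  let ?E = "\<lambda>u. (\<omega> u)\<^sup>2"
  define E' where "E' = (\<lambda>u. frechet_derivative ?E (at u) 1)"
  have E': "(?E has_real_derivative E' u) (at u)" "E' differentiable (at u)" if u: "u \<in> I" for u
    unfolding E'_def using \<omega>_square_times_differentiable[OF u, of 2] times_differentiable_on_2_real by metis+
  have pos: "\<omega> u > 0" if "u \<in> I" for u by (rule \<omega>_pos[OF that])
  have \<omega>': "(\<omega> has_real_derivative E' u / (2 * \<omega> u)) (at u)" if u: "u \<in> I" for u
  proof -
    \<comment> \<open>\<omega> inherits differentiability from its square, since the square root is
      differentiable away from 0.\<close>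
    have "((\<lambda>u. sqrt (?E u)) has_real_derivative inverse (sqrt (?E u)) / 2 * E' u) (at u)"
      by (rule DERIV_chain2[OF DERIV_real_sqrt E'(1)[OF u]]) (use pos[OF u] in simp)
    also have "inverse (sqrt (?E u)) / 2 * E' u = E' u / (2 * \<omega> u)"
      using pos[OF u] by (simp add: field_simps)
    finally show ?thesis
      by (rule has_field_derivative_transform_within_open[OF _ open_I u]) (simp add: pos less_imp_le)
  qed
  have d: "deriv \<omega> u = E' u / (2 * \<omega> u)" if "u \<in> I" for u
    using \<omega>'[OF that] by (rule DERIV_imp_deriv)
  then show "(\<omega> has_real_derivative deriv \<omega> u) (at u)"
    using \<omega>'[OF u] u by simp
  obtain E'' where E'': "(E' has_real_derivative E'') (at u)"
    using E'(2)[OF u] by (auto simp: real_differentiable_def)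
  define x :: "real^2" where "x = vector [u, 0]"
  have x: "x $ 1 = u" "x $ 1 \<in> I" using u by (simp_all add: x_def)
  obtain c W where c: "adapted_chart c W" "x \<in> W"
    using adapted_chart_exists[OF x(2)] .
  have W: "y $ 1 \<in> I" if "y \<in> W" for y
    using adapted_chartD(3)[OF c(1)] that by auto
  have "planar_gauss_curvature (\<lambda>i j x. metric_in_chart B induced_metric c x (axis i 1) (axis j 1)) x = - 1 / R\<^sup>2"
    using K c(2) adapted_chartD(1,5)[OF c(1)] unfolding constant_gauss_curvature_def by blast
  moreover have "planar_gauss_curvature (\<lambda>i j x. metric_in_chart B induced_metric c x (axis i 1) (axis j 1)) x
      = (E' (x $ 1))\<^sup>2 / (4 * (?E (x $ 1))\<^sup>2) - E'' / (2 * ?E (x $ 1))"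
    using E'' x(1) E'(1)[OF W] pos[OF W] pos[OF W, THEN less_imp_neq, symmetric]
    by (intro planar_gauss_curvature_warped[OF adapted_chartD(2)[OF c(1)] c(2)])
      (simp_all add: metric_in_adapted_chart[OF c(1)] axis_def)
  ultimately have K': "(E' u)\<^sup>2 / (4 * (\<omega> u)^4) - E'' / (2 * (\<omega> u)\<^sup>2) = - 1 / R\<^sup>2"
    using x(1) by simp
  have "((\<lambda>u. E' u / (2 * \<omega> u)) has_real_derivative
      (E'' * (2 * \<omega> u) - E' u * (2 * (E' u / (2 * \<omega> u)))) / (2 * \<omega> u)\<^sup>2) (at u)"
    using pos[OF u] by (auto intro!: derivative_eq_intros E'' \<omega>'[OF u] simp: power2_eq_square)
  \<comment> \<open>The second derivative is written as minus \<omega> times the curvature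
    expression, so that \<open>K'\<close> can be substituted.\<close>
  also have "(E'' * (2 * \<omega> u) - E' u * (2 * (E' u / (2 * \<omega> u)))) / (2 * \<omega> u)\<^sup>2
      = - \<omega> u * ((E' u)\<^sup>2 / (4 * (\<omega> u)^4) - E'' / (2 * (\<omega> u)\<^sup>2))"
    using pos[OF u] by (simp add: divide_simps) (simp add: algebra_simps eval_nat_numeral)
  also have "\<dots> = \<omega> u / R\<^sup>2"
    unfolding K' by simp
  finally show "(deriv \<omega> has_real_derivative \<omega> u / R\<^sup>2) (at u)"
    by (rule has_field_derivative_transform_within_open[OF _ open_I u]) (simp add: d)
qed

end

section \<open>Lifting curves of constant angle\<close>

text \<open>The sign of the derivative might jump, as its continuity is not given. By the mean value
  theorem, however, q multiplies all distances by the constant \<bar>k\<bar>, and such a map of an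
  interval into the line is affine.\<close>

lemma constant_abs_derivative_affine:
  fixes q :: "real \<Rightarrow> real"
  assumes T: "is_interval T" "r \<in> T" and "k \<noteq> 0"
    and D: "\<And>s. s \<in> T \<Longrightarrow> \<exists>D. (q has_real_derivative D) (at s) \<and> D\<^sup>2 = k\<^sup>2"
  shows "\<exists>\<sigma>\<in>{1, - 1}. \<forall>s\<in>T. q s = q r + \<sigma> * k * (s - r)"
proof -
  have sq': "(q b - q a)\<^sup>2 = k\<^sup>2 * (b - a)\<^sup>2" if "a \<in> T" "b \<in> T" "a < b" for a b
  proof -
    have "\<exists>D. (q has_real_derivative D) (at s) \<and> D\<^sup>2 = k\<^sup>2" if "a \<le> s" "s \<le> b" for s
      using D T(1) \<open>a \<in> T\<close> \<open>b \<in> T\<close> that by (meson mem_is_interval_1_I)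
    then obtain D where D: "(q has_real_derivative D s) (at s)" "(D s)\<^sup>2 = k\<^sup>2" if "a \<le> s" "s \<le> b" for s
      by metis
    obtain z where "a < z" "z < b" "q b - q a = (b - a) * D z"
      using MVT2[OF \<open>a < b\<close> D(1)] by blast
    then show ?thesis using D(2)[of z] by (simp add: power_mult_distrib)
  qed
  have sq: "(q b - q a)\<^sup>2 = (k * (b - a))\<^sup>2" if "a \<in> T" "b \<in> T" for a b
    using sq'[of a b] sq'[of b a] that by (cases a b rule: linorder_cases) (auto simp: power2_commute power_mult_distrib)
  show ?thesis
  proof (cases "\<exists>s\<in>T. s \<noteq> r")
    case True
    \<comment> \<open>One further point fixes the sign \<sigma>; every other point has to follow
      it.\<close>
    then obtain s1 where s1: "s1 \<in> T" "s1 \<noteq> r" by blast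
    have "q s1 - q r = 1 * k * (s1 - r) \<or> q s1 - q r = - 1 * k * (s1 - r)"
      using sq[OF T(2) s1(1)] by (auto simp: power2_eq_iff)
    then obtain \<sigma> where \<sigma>: "\<sigma> \<in> {1, - 1}" "q s1 - q r = \<sigma> * k * (s1 - r)"
      by blast
    have "q s = q r + \<sigma> * k * (s - r)" if "s \<in> T" for s
    proof (rule ccontr)
      assume "q s \<noteq> q r + \<sigma> * k * (s - r)"
      then have "q s - q r = - (\<sigma> * k * (s - r))"
        using sq[OF T(2) that] \<sigma>(1) by (auto simp: power2_eq_iff)
      \<comment> \<open>With the opposite sign at \<open>s\<close>, the distance from
        \<open>q s\<close> to \<open>q s1\<close> would belong to (s - r) + (s1 - r) instead of
        their difference, which forces one of the two terms to vanish.\<close>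
      then have q: "q s - q s1 = - (\<sigma> * k * ((s - r) + (s1 - r)))"
        using \<sigma>(2) by (simp add: algebra_simps)
      have "(q s - q s1)\<^sup>2 = k\<^sup>2 * ((s - r) + (s1 - r))\<^sup>2"
        using \<sigma>(1) unfolding q by (auto simp: power_mult_distrib)
      moreover have "(q s - q s1)\<^sup>2 = k\<^sup>2 * ((s - r) - (s1 - r))\<^sup>2"
        using sq[OF s1(1) that] by (simp add: power_mult_distrib)
      ultimately have "((s - r) + (s1 - r))\<^sup>2 = ((s - r) - (s1 - r))\<^sup>2"
        using \<open>k \<noteq> 0\<close> by simp
      then have "4 * ((s - r) * (s1 - r)) = 0"
        by (simp add: power2_eq_square algebra_simps)
      then have "s = r" using s1(2) by simp
      then show False using \<open>q s \<noteq> _\<close> by simp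
    qed
    then show ?thesis using \<sigma>(1) by blast
  next
    case False
    then show ?thesis by auto
  qed
qed

context adapted_surface
begin

text \<open>It asks for pointwise differentiability where \<open>loxodrome\<close> asks for a smooth
  curve. Thus it also covers \<open>\<gamma>M\<close> with the angle \<pi>/2, so the lifting lemma
  applies both to loxodromes and to the profile curve.\<close>

definition constant_angle :: "real set \<Rightarrow> (real \<Rightarrow> 'm) \<Rightarrow> real \<Rightarrow> bool" where
  "constant_angle J \<beta> \<theta> \<longleftrightarrow> (\<forall>s\<in>J. differentiable_into B \<beta> s \<and>
     induced_metric (\<beta> s) (velocity B \<beta> s) (velocity B \<beta> s) = 1 \<and>
     g (f (\<beta> s)) (velocity A (f \<circ> \<beta>) s) (X (f (\<beta> s)))
       = tangent_norm g (f (\<beta> s)) (X (f (\<beta> s))) * cos \<theta>)"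

lemma tangent_norm_X:
  assumes "u \<in> I"
  shows "tangent_norm g (f (\<Psi> u v)) (X (f (\<Psi> u v))) = \<omega> u"
proof -
  define x :: "real^2" where "x = vector [u, v]"
  have x: "x $ 1 \<in> I" "param_map x = \<Psi> u v" using assms by (simp_all add: x_def)
  have "g (f (param_map x)) (X (f (param_map x))) (X (f (param_map x))) = (\<omega> u)\<^sup>2"
    using first_fundamental_form[OF x(1), of "axis 2 1" "axis 2 1"] unfolding push_axis_2[OF x(1)]
    by (simp add: axis_def x_def)
  then show ?thesis
    using \<omega>_pos[OF assms] unfolding x(2) by (simp add: tangent_norm_def)
qed

text \<open>In an adapted chart around the prescribed preimage the two conditions read
  \<open>u'\<^sup>2 + \<omega>\<^sup>2 v'\<^sup>2 = 1\<close> and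
  \<open>\<omega> v' = cos \<theta>\<close>. They determine v' and the square of u'; the constant
  square makes u affine.\<close>

lemma constant_angle_local_lift:
  assumes J: "open J" and \<beta>: "constant_angle J \<beta> \<theta>" and \<theta>: "sin \<theta> \<noteq> 0"
    and s0: "s0 \<in> J" and u0: "u0 \<in> I" and eq: "\<beta> s0 = \<Psi> u0 v0"
  shows "\<exists>\<delta>>0. \<exists>\<sigma>\<in>{1, - 1}. \<exists>v. v s0 = v0 \<and> (\<forall>s. \<bar>s - s0\<bar> < \<delta> \<longrightarrow>
    s \<in> J \<and> u0 + \<sigma> * sin \<theta> * (s - s0) \<in> I \<and> \<beta> s = \<Psi> (u0 + \<sigma> * sin \<theta> * (s - s0)) (v s) \<and>
    (v has_real_derivative cos \<theta> / \<omega> (u0 + \<sigma> * sin \<theta> * (s - s0))) (at s))"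
proof -
  define x0 :: "real^2" where "x0 = vector [u0, v0]"
  have x0: "x0 $ 1 = u0" "x0 $ 2 = v0" "x0 $ 1 \<in> I" using u0 by (simp_all add: x0_def)
  obtain c W where c: "adapted_chart c W" "x0 \<in> W"
    using adapted_chart_exists[OF x0(3)] .
  note ic = smooth_structure_is_chart[OF B adapted_chartD(1)[OF c(1)]]
  have \<beta>0: "\<beta> s0 = param_map x0" using eq x0 by simp
  have "eventually (\<lambda>s. \<beta> s \<in> fst c) (nhds s0)"
    using \<beta> s0 c(2) adapted_chartD(4)[OF c(1)] \<beta>0
    by (intro eventually_nhds_isCont open_chart_domain[OF ic]) (auto simp: constant_angle_def differentiable_into_def)
  with eventually_nhds_in_open[OF J s0] have "eventually (\<lambda>s. s \<in> J \<and> \<beta> s \<in> fst c) (nhds s0)"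
    by (rule eventually_conj)
  then obtain \<delta> where \<delta>: "\<delta> > 0" "\<And>s. \<bar>s - s0\<bar> < \<delta> \<Longrightarrow> s \<in> J \<and> \<beta> s \<in> fst c"
    by (auto simp: eventually_nhds_metric dist_real_def)
  define T where "T = {s0 - \<delta><..<s0 + \<delta>}"
  have T: "s \<in> T \<longleftrightarrow> \<bar>s - s0\<bar> < \<delta>" for s by (auto simp: T_def)
  define y where "y = snd c \<circ> \<beta>"
  have y: "y s \<in> W" "\<beta> s = param_map (y s)" "y s $ 1 \<in> I" if "s \<in> T" for s
  proof -
    have \<beta>s: "\<beta> s \<in> fst c" using that \<delta>(2) T by blast
    then show "y s \<in> W" using adapted_chartD(5)[OF c(1)] by (auto simp: y_def)
    then show "\<beta> s = param_map (y s)" "y s $ 1 \<in> I"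
      using adapted_chartD(3,7)[OF c(1)] chart_inv_left[OF ic \<beta>s] by (auto simp: y_def)
  qed
  have y0: "y s0 = x0"
    using adapted_chartD(6)[OF c(1) c(2)] \<beta>0 by (simp add: y_def)
  define y' where "y' = (\<lambda>s. frechet_derivative y (at s) 1)"
  have dy: "((\<lambda>s. y s $ i) has_real_derivative y' s $ i) (at s)" and y1': "(y' s $ 1)\<^sup>2 = (sin \<theta>)\<^sup>2"
    and y2': "y' s $ 2 = cos \<theta> / \<omega> (y s $ 1)" if s: "s \<in> T" for s i
  proof -
    have sJ: "s \<in> J" using s T \<delta> by blast
    have \<beta>s: "differentiable_into B \<beta> s" "induced_metric (\<beta> s) (velocity B \<beta> s) (velocity B \<beta> s) = 1"
      "g (f (\<beta> s)) (velocity A (f \<circ> \<beta>) s) (X (f (\<beta> s))) = tangent_norm g (f (\<beta> s)) (X (f (\<beta> s))) * cos \<theta>"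
      using \<beta> sJ by (auto simp: constant_angle_def)
    have yd: "y differentiable (at s)"
      using \<beta>s(1) s \<delta>(2) T adapted_chartD(1)[OF c(1)] by (auto simp: differentiable_into_def y_def)
    then have "(y has_vector_derivative y' s) (at s)"
      by (simp add: y'_def frechet_derivative_eq_vector_derivative vector_derivative_works)
    then show "((\<lambda>s. y s $ i) has_real_derivative y' s $ i) (at s)"
      by (simp add: has_real_derivative_iff_has_vector_derivative bounded_linear.has_vector_derivative[OF bounded_linear_vec_nth])
    have ev: "eventually (\<lambda>s. \<beta> s = param_map (y s)) (nhds s)"
      using eventually_nhds_in_open[of T s] s y(2) by (auto simp: T_def elim: eventually_mono)
    then have evf: "eventually (\<lambda>s. (f \<circ> \<beta>) s = f (param_map (y s))) (nhds s)"
      by (rule eventually_mono) simp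
    have vB: "velocity B \<beta> s = pushforward B param_map (y s) (y' s)"
      unfolding velocity_eq_pushforward[OF \<beta>s(1)] differentiable_into_cong(2)[OF ev] y'_def
      by (rule differentiable_into_compose(2)[where F = param_map, OF differentiable_param_map[OF y(3)[OF s]] yd])
    note df = differentiable_f_param(1)[OF y(3)[OF s]]
    have "differentiable_into A (f \<circ> \<beta>) s"
      unfolding differentiable_into_cong(1)[OF evf]
      by (rule differentiable_into_compose(1)[where F = "\<lambda>y. f (param_map y)", OF df yd])
    then have vA: "velocity A (f \<circ> \<beta>) s = pushforward A (\<lambda>y. f (param_map y)) (y s) (y' s)"
      unfolding velocity_eq_pushforward[OF \<open>differentiable_into A (f \<circ> \<beta>) s\<close>]
        differentiable_into_cong(2)[OF evf] y'_def
      by (intro differentiable_into_compose(2)[where F = "\<lambda>y. f (param_map y)", OF df yd])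
    have "induced_metric (\<beta> s) (velocity B \<beta> s) (velocity B \<beta> s)
        = y' s $ 1 * y' s $ 1 + (\<omega> (y s $ 1))\<^sup>2 * (y' s $ 2 * y' s $ 2)"
      unfolding vB pullback_metric_def y(2)[OF s] differentiable_f_param(2)[OF y(3)[OF s]]
      by (rule first_fundamental_form[OF y(3)[OF s]])
    then have n: "(y' s $ 1)\<^sup>2 + (\<omega> (y s $ 1) * y' s $ 2)\<^sup>2 = 1"
      using \<beta>s(2) by (simp add: power2_eq_square algebra_simps)
    \<comment> \<open>X is the second coordinate vector, so pairing with it reads off the second
      component of the velocity, weighted by \<open>\<omega>\<^sup>2\<close>.\<close>
    have "g (f (\<beta> s)) (velocity A (f \<circ> \<beta>) s) (X (f (\<beta> s))) = (\<omega> (y s $ 1))\<^sup>2 * y' s $ 2"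
      unfolding vA y(2)[OF s] push_axis_2[OF y(3)[OF s], symmetric] first_fundamental_form[OF y(3)[OF s]]
      by (simp add: axis_def)
    then have "(\<omega> (y s $ 1))\<^sup>2 * y' s $ 2 = \<omega> (y s $ 1) * cos \<theta>"
      using \<beta>s(3) y(2)[OF s] tangent_norm_X[OF y(3)[OF s]] by simp
    then have 2: "\<omega> (y s $ 1) * y' s $ 2 = cos \<theta>"
      using \<omega>_pos[OF y(3)[OF s]] by (simp add: power2_eq_square)
    then show "y' s $ 2 = cos \<theta> / \<omega> (y s $ 1)"
      using \<omega>_pos[OF y(3)[OF s]] by (simp add: field_simps)
    show "(y' s $ 1)\<^sup>2 = (sin \<theta>)\<^sup>2"
      using n unfolding 2 by (simp add: sin_squared_eq)
  qed
  have "s0 \<in> T" using \<delta>(1) by (simp add: T_def)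
  have "\<exists>\<sigma>\<in>{1, - 1}. \<forall>s\<in>T. y s $ 1 = y s0 $ 1 + \<sigma> * sin \<theta> * (s - s0)"
    by (rule constant_abs_derivative_affine[OF _ \<open>s0 \<in> T\<close> \<theta>]) (use dy y1' in \<open>auto simp: T_def\<close>)
  then obtain \<sigma> where \<sigma>: "\<sigma> \<in> {1, - 1}" "\<And>s. s \<in> T \<Longrightarrow> y s $ 1 = y s0 $ 1 + \<sigma> * sin \<theta> * (s - s0)"
    by blast
  show ?thesis
  proof (intro exI[of _ \<delta>] bexI[of _ \<sigma>] exI[of _ "\<lambda>s. y s $ 2"] conjI allI impI)
    show "\<delta> > 0" "\<sigma> \<in> {1, - 1}" "y s0 $ 2 = v0"
      using \<delta>(1) \<sigma>(1) y0 x0 by auto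
    fix s assume "\<bar>s - s0\<bar> < \<delta>"
    then have s: "s \<in> T" using T by blast
    have y1: "y s $ 1 = u0 + \<sigma> * sin \<theta> * (s - s0)"
      using \<sigma>(2)[OF s] y0 x0 by simp
    show "s \<in> J" using s T \<delta>(2) by blast
    show "u0 + \<sigma> * sin \<theta> * (s - s0) \<in> I" using y(3)[OF s] y1 by simp
    show "\<beta> s = \<Psi> (u0 + \<sigma> * sin \<theta> * (s - s0)) (y s $ 2)" using y(2)[OF s] y1 by simp
    show "((\<lambda>s. y s $ 2) has_real_derivative cos \<theta> / \<omega> (u0 + \<sigma> * sin \<theta> * (s - s0))) (at s)"
      using dy[OF s, of 2] y2'[OF s] y1 by simp
  qed
qed

end

text \<open>The set of agreement is closed in \<open>T\<close> because the target is Hausdorff, and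
  open by the local hypothesis. It replaces the uniqueness of lifts, which a mere local
  diffeomorphism does not offer globally.\<close>

lemma eq_on_connected:
  fixes p q :: "real \<Rightarrow> 'm::t2_space"
  assumes T: "connected T" "s0 \<in> T" and cont: "continuous_on T p" "continuous_on T q"
    and s0: "p s0 = q s0"
    and local: "\<And>s. s \<in> T \<Longrightarrow> p s = q s \<Longrightarrow> \<exists>\<delta>>0. \<forall>r. \<bar>r - s\<bar> < \<delta> \<longrightarrow> p r = q r"
    and s: "s \<in> T"
  shows "p s = q s"
proof -
  let ?S = "T \<inter> (\<lambda>s. (p s, q s)) -` {y. \<exists>x. y = (x, x)}"
  have "closedin (top_of_set T) ?S"
    using cont by (intro continuous_closedin_preimage continuous_on_Pair closed_diagonal)
  moreover have "openin (top_of_set T) ?S"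
    unfolding openin_euclidean_subtopology_iff
  proof (intro conjI ballI)
    fix s assume "s \<in> ?S"
    then obtain \<delta> where "\<delta> > 0" "\<And>r. \<bar>r - s\<bar> < \<delta> \<Longrightarrow> p r = q r"
      using local[of s] by auto
    then show "\<exists>e>0. \<forall>r\<in>T. dist r s < e \<longrightarrow> r \<in> ?S"
      by (intro exI[of _ \<delta>]) (auto simp: dist_real_def)
  qed blast
  moreover have "s0 \<in> ?S"
    using T(2) s0 by auto
  ultimately have "?S = T"
    using T(1) unfolding connected_clopen by blast
  then have "s \<in> ?S" using s by simp
  then show ?thesis by auto
qed

section \<open>Uniqueness of the first coordinate\<close>

context adapted_surface
begin

text \<open>\<open>\<gamma>M\<close> is the coordinate line v = 0; its differentiability comes from
  that of \<open>param_map\<close>, and its velocity is the first coordinate vector, of length 1 and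
  orthogonal to X.\<close>

lemma constant_angle_\<gamma>M: "constant_angle I \<gamma>M (pi / 2)"
  unfolding constant_angle_def
proof (intro ballI conjI)
  fix u assume u: "u \<in> I"
  define x :: "real^2" where "x = axis 1 u"
  have x: "x $ 1 = u" "x $ 1 \<in> I" "x $ 2 = 0" using u by (simp_all add: x_def axis_def)
  let ?k = "\<lambda>s::real. 0 + s *\<^sub>R (axis 1 1 :: real^2)"
  have k: "?k u = x" by (simp add: x_def vec_eq_iff axis_def)
  have \<gamma>M': "\<gamma>M s = param_map (?k s)" for s
    by (simp add: axis_def \<Psi>_0)
  have d: "differentiable_into B param_map (?k u)"
    unfolding k by (rule differentiable_param_map[OF x(2)])
  have df: "differentiable_into A (\<lambda>y. f (param_map y)) (?k u)"
    unfolding k by (rule differentiable_f_param(1)[OF x(2)])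
  note line = frechet_derivative_line[of "0::real^2" "axis 1 1" u]
  have eqM: "\<gamma>M = (\<lambda>s. param_map (?k s))"
    using \<gamma>M' by blast
  then show dM: "differentiable_into B \<gamma>M u"
    using differentiable_into_compose(1)[of B param_map ?k u, OF d line(1)] by simp
  have "velocity B \<gamma>M u = pushforward B (\<lambda>s. param_map (?k s)) u 1"
    unfolding velocity_eq_pushforward[OF dM] by (simp only: eqM)
  also have "\<dots> = pushforward B param_map x (axis 1 1)"
    using differentiable_into_compose(2)[of B param_map ?k u 1, OF d line(1)] unfolding line(2) k .
  finally have vB: "velocity B \<gamma>M u = pushforward B param_map x (axis 1 1)" .
  have fM: "\<gamma>M u = param_map x" unfolding \<gamma>M'[of u] k ..
  show "induced_metric (\<gamma>M u) (velocity B \<gamma>M u) (velocity B \<gamma>M u) = 1"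
    unfolding vB fM pullback_metric_def differentiable_f_param(2)[OF x(2)] first_fundamental_form[OF x(2)]
    by (simp add: axis_def)
  have "(f \<circ> \<gamma>M) = (\<lambda>s. f (param_map (?k s)))"
    using \<gamma>M' by (simp add: fun_eq_iff)
  moreover from this have "differentiable_into A (f \<circ> \<gamma>M) u"
    using differentiable_into_compose(1)[of A "\<lambda>y. f (param_map y)" ?k u, OF df line(1)] by simp
  ultimately have vA: "velocity A (f \<circ> \<gamma>M) u = pushforward A (\<lambda>y. f (param_map y)) x (axis 1 1)"
    using differentiable_into_compose(2)[of A "\<lambda>y. f (param_map y)" ?k u 1, OF df line(1)]
    unfolding velocity_eq_pushforward[OF \<open>differentiable_into A (f \<circ> \<gamma>M) u\<close>] line(2) k by simp
  show "g (f (\<gamma>M u)) (velocity A (f \<circ> \<gamma>M) u) (X (f (\<gamma>M u)))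
      = tangent_norm g (f (\<gamma>M u)) (X (f (\<gamma>M u))) * cos (pi / 2)"
    unfolding vA fM push_axis_2[OF x(2), symmetric] first_fundamental_form[OF x(2)]
    by (simp add: axis_def)
qed

text \<open>If the reflection at \<open>m\<close> preserved the curve near \<open>m\<close>, the
  velocity at \<open>m\<close> would equal its own negative, hence have length 0 instead of
  1.\<close>

lemma \<gamma>q_not_symmetric:
  assumes "m \<in> I" "\<delta> > 0" and eq: "\<And>r. 0 < r \<Longrightarrow> r < \<delta> \<Longrightarrow> \<gamma>q (m + r) = \<gamma>q (m - r)"
  shows False
proof -
  have Q: "smooth_structure Q" "riemannian_metric Q gq"
    using orbit_space by (simp_all add: riemannian_orbit_space_def)
  have d: "differentiable_into Q \<gamma>q m"
    using \<gamma>q smooth_curve_differentiable_into[of Q I \<gamma>q m] open_I assms(1) by (simp add: unit_speed_def)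
  let ?b = "\<lambda>v w. gq (\<gamma>q m) (pushforward Q \<gamma>q m v) (pushforward Q \<gamma>q m w)"
  note b = bilinear_pushforward_metric(1)[OF Q d]
  have "eventually (\<lambda>s. s \<in> {m - \<delta><..<m + \<delta>}) (nhds m)"
    using \<open>\<delta> > 0\<close> by (intro eventually_nhds_in_open) auto
  then have ev: "eventually (\<lambda>s. \<gamma>q (2 * m + s *\<^sub>R (- 1)) = \<gamma>q s) (nhds m)"
  proof (rule eventually_mono)
    fix s assume "s \<in> {m - \<delta><..<m + \<delta>}"
    then show "\<gamma>q (2 * m + s *\<^sub>R (- 1)) = \<gamma>q s"
      using eq[of "s - m"] eq[of "m - s"] by (cases s m rule: linorder_cases) (auto simp: algebra_simps)
  qed
  have "pushforward Q (\<lambda>s. \<gamma>q (2 * m + s *\<^sub>R (- 1))) m 1 = pushforward Q \<gamma>q m (- 1)"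
    using differentiable_into_compose(2)[of Q \<gamma>q "\<lambda>s. 2 * m + s *\<^sub>R (- 1)" m 1]
      frechet_derivative_line[of "2 * m" "- 1::real" m] d by simp
  then have "pushforward Q \<gamma>q m 1 = pushforward Q \<gamma>q m (- 1)"
    by (simp only: differentiable_into_cong(2)[OF ev])
  then have "?b 1 1 = ?b 1 (- 1)" by simp
  also have "\<dots> = - ?b 1 1"
    using bilinear_rneg[OF b, of 1 1] .
  finally have "?b 1 1 = 0" by simp
  moreover have "?b 1 1 = 1"
    using \<gamma>q assms(1) unfolding velocity_eq_pushforward[OF d, symmetric]
    by (simp add: unit_speed_def tangent_norm_def)
  ultimately show False by simp
qed

text \<open>
  The coincidence propagates because \<open>\<gamma>M\<close> is itself a curve of constant angle \<open>\<pi>/2\<close>;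
  it does so with reversed direction because \<open>\<omega>'\<close> is strictly increasing.
\<close>

lemma \<gamma>M_coincidence_reflects:
  assumes R: "R \<noteq> 0" and K: "constant_gauss_curvature B induced_metric (- 1 / R\<^sup>2)"
    and u: "u1 \<in> I" "u2 \<in> I" "u1 < u2" and eq: "\<gamma>M u2 = \<Psi> u1 t"
  shows "\<exists>\<delta>>0. \<forall>s. \<bar>s - u2\<bar> < \<delta> \<longrightarrow> \<gamma>M s = \<Psi> (u1 + u2 - s) t"
proof -
  note ode = \<omega>_ode[OF R K]
  have "sin (pi / 2) \<noteq> (0::real)" by simp
  from constant_angle_local_lift[OF open_I constant_angle_\<gamma>M this u(2,1) eq]
  obtain \<delta> \<sigma> v where \<delta>: "\<delta> > 0" and \<sigma>: "\<sigma> \<in> {1, - 1}" and v: "v u2 = t"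
    and lift: "\<forall>s. \<bar>s - u2\<bar> < \<delta> \<longrightarrow> s \<in> I \<and> u1 + \<sigma> * sin (pi / 2) * (s - u2) \<in> I \<and>
      \<gamma>M s = \<Psi> (u1 + \<sigma> * sin (pi / 2) * (s - u2)) (v s) \<and>
      (v has_real_derivative cos (pi / 2) / \<omega> (u1 + \<sigma> * sin (pi / 2) * (s - u2))) (at s)"
    by blast
  \<comment> \<open>For the right angle the derivative of v is cos(\<pi>/2)/\<omega> = 0, so the
    lift of \<open>\<gamma>M\<close> stays on one horizontal line.\<close>
  have vt: "v s = t" if s: "\<bar>s - u2\<bar> < \<delta>" for s
  proof -
    have "(v has_real_derivative 0) (at r within {u2 - \<delta><..<u2 + \<delta>})" if "r \<in> {u2 - \<delta><..<u2 + \<delta>}" for r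
    proof -
      have "\<bar>r - u2\<bar> < \<delta>" using that by auto
      with lift have "(v has_real_derivative cos (pi / 2) / \<omega> (u1 + \<sigma> * sin (pi / 2) * (r - u2))) (at r)"
        by blast
      then show ?thesis by (simp add: has_field_derivative_at_within)
    qed
    then have "\<exists>c. \<forall>r\<in>{u2 - \<delta><..<u2 + \<delta>}. v r = c"
      by (intro has_field_derivative_zero_constant) auto
    then obtain c where c: "\<forall>r\<in>{u2 - \<delta><..<u2 + \<delta>}. v r = c" by blast
    then have "v s = v u2" using s \<delta> by (auto simp: abs_less_iff)
    then show ?thesis using v by simp
  qed
  have \<gamma>M_eq: "\<gamma>M s = \<Psi> (u1 + \<sigma> * (s - u2)) t" "s \<in> I" "u1 + \<sigma> * (s - u2) \<in> I" if "\<bar>s - u2\<bar> < \<delta>" for s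
    using lift that vt[OF that] by simp_all
  have "\<sigma> \<noteq> 1"
  proof
    assume "\<sigma> = 1"
    \<comment> \<open>\<omega> is the length of X at the image point, so curves that coincide have
      equal \<omega>. With equal directions, differentiating gives the same \<omega>' at
      \<open>u1\<close> and \<open>u2\<close>.\<close>
    have \<omega>_eq: "\<omega> s = \<omega> (u1 + (s - u2))" if "s \<in> {u2 - \<delta><..<u2 + \<delta>}" for s
    proof -
      have s: "\<bar>s - u2\<bar> < \<delta>" using that by auto
      have "tangent_norm g (f (\<gamma>M s)) (X (f (\<gamma>M s))) = \<omega> s"
        using tangent_norm_X[OF \<gamma>M_eq(2)[OF s], of 0] by (simp add: \<Psi>_0)
      moreover have "tangent_norm g (f (\<gamma>M s)) (X (f (\<gamma>M s))) = \<omega> (u1 + (s - u2))"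
        using tangent_norm_X[OF \<gamma>M_eq(3)[OF s], of t] \<gamma>M_eq(1)[OF s] \<open>\<sigma> = 1\<close> by simp
      ultimately show ?thesis by simp
    qed
    have "((\<lambda>s. \<omega> (u1 + (s - u2))) has_real_derivative deriv \<omega> u1 * 1) (at u2)"
      by (rule DERIV_chain2[where f = \<omega>]) (use ode(1)[OF u(1)] in \<open>auto intro!: derivative_eq_intros\<close>)
    then have "(\<omega> has_real_derivative deriv \<omega> u1 * 1) (at u2)"
      by (rule has_field_derivative_transform_within_open[of _ _ _ "{u2 - \<delta><..<u2 + \<delta>}"])
        (use \<delta> \<omega>_eq in auto)
    then have "deriv \<omega> u2 = deriv \<omega> u1"
      using DERIV_imp_deriv by fastforce
    \<comment> \<open>Negative curvature enters here: \<omega>'' is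
      \<open>\<omega> / R\<^sup>2\<close>, which is positive.\<close>
    moreover have "deriv \<omega> u1 < deriv \<omega> u2"
    proof (rule DERIV_pos_imp_increasing[OF u(3)])
      fix x assume "u1 \<le> x" "x \<le> u2"
      then have "x \<in> I" using u interval_I by (meson mem_is_interval_1_I)
      then show "\<exists>y. (deriv \<omega> has_real_derivative y) (at x) \<and> 0 < y"
        using ode(2) \<omega>_pos R by (intro exI[of _ "\<omega> x / R\<^sup>2"]) auto
    qed
    ultimately show False by simp
  qed
  then have "\<sigma> = - 1" using \<sigma> by simp
  then have "\<gamma>M s = \<Psi> (u1 + u2 - s) t" if "\<bar>s - u2\<bar> < \<delta>" for s
    using \<gamma>M_eq(1)[OF that] by (simp add: algebra_simps)
  then show ?thesis using \<delta> by blast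
qed

lemma isCont_param_map: "x $ 1 \<in> I \<Longrightarrow> isCont param_map x"
  using differentiable_param_map by (simp add: differentiable_into_def)

lemma continuous_on_\<Psi>:
  assumes "continuous_on S p" "continuous_on S q" "p ` S \<subseteq> I"
  shows "continuous_on S (\<lambda>s. \<Psi> (p s) (q s))"
proof -
  have "continuous_on {x. x $ 1 \<in> I} param_map"
    using isCont_param_map by (auto intro: continuous_at_imp_continuous_on)
  moreover have "continuous_on S (\<lambda>s. p s *\<^sub>R axis 1 1 + q s *\<^sub>R axis 2 1 :: real^2)"
    using assms by (intro continuous_intros)
  moreover have "(\<lambda>s. p s *\<^sub>R axis 1 1 + q s *\<^sub>R axis 2 1 :: real^2) ` S \<subseteq> {x. x $ 1 \<in> I}"
    using assms(3) by (auto simp: axis_def)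
  ultimately have "continuous_on S (\<lambda>s. param_map (p s *\<^sub>R axis 1 1 + q s *\<^sub>R axis 2 1))"
    by (rule continuous_on_compose2)
  then show ?thesis by (simp add: axis_def)
qed

lemma \<Psi>_first_coordinate_less:
  assumes R: "R \<noteq> 0" and K: "constant_gauss_curvature B induced_metric (- 1 / R\<^sup>2)"
    and u: "u1 \<in> I" "u2 \<in> I" "u1 < u2" and eq: "\<Psi> u1 v1 = \<Psi> u2 v2"
  shows False
proof -
  define t where "t = v1 - v2"
  define m where "m = (u1 + u2) / 2"
  have mI: "s \<in> I" if "u1 \<le> s" "s \<le> u2" for s
    using u interval_I that by (meson mem_is_interval_1_I)
  \<comment> \<open>Acting by \<open>\<phi> (- v2)\<close> moves the second representation to v = 0,
    so that the common point lies on \<open>\<gamma>M\<close>.\<close>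
  have "act (\<phi> (- v2)) (\<Psi> u1 v1) = act (\<phi> (- v2)) (\<Psi> u2 v2)"
    using eq by simp
  then have eq0: "\<gamma>M u2 = \<Psi> u1 t"
    by (simp add: act_\<Psi> \<Psi>_0 t_def)
  \<comment> \<open>The midpoint is excluded: there the parameters \<open>s\<close> and
    \<open>u1 + u2 - s\<close> coincide, while the propagation lemma compares two distinct
    ones.\<close>
  let ?T = "{m<..u2}"
  have "?T \<subseteq> I" using mI u by (auto simp: m_def)
  have eq': "\<gamma>M s = \<Psi> (u1 + u2 - s) t" if "s \<in> ?T" for s
  proof (rule eq_on_connected[of ?T u2 \<gamma>M "\<lambda>s. \<Psi> (u1 + u2 - s) t"])
    show "continuous_on ?T \<gamma>M"
      using continuous_on_\<Psi>[of ?T "\<lambda>s. s" "\<lambda>_. 0"] \<open>?T \<subseteq> I\<close> by (simp add: \<Psi>_0)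
    show "continuous_on ?T (\<lambda>s. \<Psi> (u1 + u2 - s) t)"
      using u by (intro continuous_on_\<Psi> continuous_intros) (auto intro!: mI simp: m_def field_simps)
    fix s assume "s \<in> ?T" "\<gamma>M s = \<Psi> (u1 + u2 - s) t"
    then show "\<exists>\<delta>>0. \<forall>r. \<bar>r - s\<bar> < \<delta> \<longrightarrow> \<gamma>M r = \<Psi> (u1 + u2 - r) t"
      using \<gamma>M_coincidence_reflects[OF R K, of "u1 + u2 - s" s t] mI u by (auto simp: m_def field_simps)
  qed (use u eq0 that in \<open>auto simp: m_def\<close>)
  have "\<gamma>q (m + r) = \<gamma>q (m - r)" if "0 < r" "r < u2 - m" for r
  proof -
    have I: "m + r \<in> I" "m - r \<in> I" using that u by (auto intro!: mI simp: m_def field_simps)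
    have "\<gamma>M (m + r) = \<Psi> (m - r) t"
      using eq'[of "m + r"] that by (simp add: m_def field_simps)
    then have fl: "\<gamma> (m + r) = \<phi> t (\<gamma> (m - r))"
      using \<gamma>M[OF I(1)] f_\<Psi>[OF I(2), of t] by simp
    have "\<forall>p\<in>regular_part (range \<phi>). \<forall>q\<in>regular_part (range \<phi>).
        \<pi> p = \<pi> q \<longleftrightarrow> orbit_of (range \<phi>) p = orbit_of (range \<phi>) q"
      using orbit_space by (simp add: riemannian_orbit_space_def)
    \<comment> \<open>Projecting to the orbit space removes the shift by \<open>t\<close> and leaves
      a true reflection symmetry of the profile curve about \<open>m\<close>.\<close>
    then have "\<pi> (\<gamma> (m + r)) = \<pi> (\<gamma> (m - r))"
      using \<gamma>(2)[OF I(1)] \<gamma>(2)[OF I(2)] orbit_flow[of t "\<gamma> (m - r)"] unfolding fl by blast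
    then show ?thesis using \<gamma>(2)[OF I(1)] \<gamma>(2)[OF I(2)] by simp
  qed
  then show False
    using \<gamma>q_not_symmetric[of m "u2 - m"] mI u by (auto simp: m_def field_simps)
qed

lemma \<Psi>_first_coordinate:
  assumes "R \<noteq> 0" "constant_gauss_curvature B induced_metric (- 1 / R\<^sup>2)"
    and "u1 \<in> I" "u2 \<in> I" "\<Psi> u1 v1 = \<Psi> u2 v2"
  shows "u1 = u2"
  using \<Psi>_first_coordinate_less[OF assms(1-4) _ assms(5)] \<Psi>_first_coordinate_less[OF assms(1,2,4,3) _ assms(5)[symmetric]]
  by (cases u1 u2 rule: linorder_cases) auto

section \<open>Loxodromes\<close>

lemma loxodrome_constant_angle:
  assumes "loxodrome A g X B f J \<alpha> \<theta>"
  shows "constant_angle J \<alpha> \<theta>"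
proof -
  have "open J" "smooth_curve B J \<alpha>"
    using assms by (auto simp: loxodrome_def open_interval_def unit_speed_def)
  then show ?thesis
    using assms smooth_curve_differentiable_into[OF \<open>smooth_curve B J \<alpha>\<close> \<open>open J\<close>]
    by (auto simp: constant_angle_def loxodrome_def unit_speed_def tangent_norm_def)
qed

text \<open>\<open>V\<close> may be any primitive of cot \<theta>/\<omega>, so the sign of
  \<open>a\<close> plays no part in the geometry; it only selects the primitive later.\<close>

lemma loxodrome_graph:
  assumes R: "R \<noteq> 0" and K: "constant_gauss_curvature B induced_metric (- 1 / R\<^sup>2)"
    and lox: "loxodrome A g X B f J \<alpha> \<theta>" "\<theta> \<noteq> 0" "\<alpha> ` J \<subseteq> {\<Psi> u v | u v. u \<in> I}"
    and V: "\<And>u. u \<in> I \<Longrightarrow> (V has_real_derivative cot \<theta> / \<omega> u) (at u)"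
  shows "\<exists>\<epsilon>\<in>{1, - 1}. \<exists>b \<eta>. smooth_on J \<eta> \<and> (\<forall>s\<in>J. deriv \<eta> s \<noteq> 0) \<and> inj_on \<eta> J \<and> \<eta> ` J \<subseteq> I \<and>
    (\<forall>s\<in>J. \<alpha> s = \<Psi> (\<eta> s) (\<epsilon> * V (\<eta> s) + b))"
proof -
  have J: "open J" "is_interval J" "J \<noteq> {}" and "0 \<le> \<theta>" "\<theta> < pi"
    using lox(1) by (auto simp: loxodrome_def open_interval_def)
  then have sin: "sin \<theta> > 0"
    using lox(2) by (intro sin_gt_zero) auto
  note ca = loxodrome_constant_angle[OF lox(1)]
  have "\<exists>u v. u \<in> I \<and> \<alpha> s = \<Psi> u v" if "s \<in> J" for s
    using lox(3) that by blast
  then obtain \<eta>0 \<nu> where rep: "\<And>s. s \<in> J \<Longrightarrow> \<eta>0 s \<in> I" "\<And>s. s \<in> J \<Longrightarrow> \<alpha> s = \<Psi> (\<eta>0 s) (\<nu> s)"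
    by metis
  \<comment> \<open>The chosen preimages need not depend continuously on \<open>s\<close>, but by
    uniqueness of u their first coordinate \<open>\<eta>0\<close> agrees with that of every local
    lift.\<close>
  have unique: "\<eta>0 s = u" if "s \<in> J" "u \<in> I" "\<alpha> s = \<Psi> u v" for s u v
    using \<Psi>_first_coordinate[OF R K rep(1)[OF that(1)] that(2)] rep(2)[OF that(1)] that(3) by metis
  have D: "\<exists>D. (\<eta>0 has_real_derivative D) (at s) \<and> D\<^sup>2 = (sin \<theta>)\<^sup>2" if s: "s \<in> J" for s
  proof -
    from constant_angle_local_lift[OF J(1) ca less_imp_neq[OF sin, symmetric] s rep(1)[OF s] rep(2)[OF s]]
    obtain \<delta> \<sigma> v where "\<delta> > 0" "\<sigma> \<in> {1, - 1}" and lift: "\<forall>r. \<bar>r - s\<bar> < \<delta> \<longrightarrow> r \<in> J \<and>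
      \<eta>0 s + \<sigma> * sin \<theta> * (r - s) \<in> I \<and> \<alpha> r = \<Psi> (\<eta>0 s + \<sigma> * sin \<theta> * (r - s)) (v r)"
      by blast
    have eq: "\<eta>0 s + \<sigma> * sin \<theta> * (r - s) = \<eta>0 r" if "r \<in> {s - \<delta><..<s + \<delta>}" for r
    proof -
      have "\<bar>r - s\<bar> < \<delta>" using that by auto
      with lift have "r \<in> J" "\<eta>0 s + \<sigma> * sin \<theta> * (r - s) \<in> I"
        "\<alpha> r = \<Psi> (\<eta>0 s + \<sigma> * sin \<theta> * (r - s)) (v r)" by blast+
      from unique[OF this] show ?thesis ..
    qed
    have "((\<lambda>r. \<eta>0 s + \<sigma> * sin \<theta> * (r - s)) has_real_derivative \<sigma> * sin \<theta>) (at s)"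
      by (auto intro!: derivative_eq_intros)
    then have "(\<eta>0 has_real_derivative \<sigma> * sin \<theta>) (at s)"
      by (rule has_field_derivative_transform_within_open[of _ _ _ "{s - \<delta><..<s + \<delta>}"]) (use \<open>\<delta> > 0\<close> eq in auto)
    then show ?thesis using \<open>\<sigma> \<in> {1, - 1}\<close> by auto
  qed
  obtain s0 where s0: "s0 \<in> J" using J(3) by blast
  obtain \<epsilon> where \<epsilon>: "\<epsilon> \<in> {1, - 1}" "\<And>s. s \<in> J \<Longrightarrow> \<eta>0 s = \<eta>0 s0 + \<epsilon> * sin \<theta> * (s - s0)"
    using constant_abs_derivative_affine[OF J(2) s0 less_imp_neq[OF sin, symmetric] D] by blast
  define \<eta> where "\<eta> = (\<lambda>s. \<eta>0 s0 + \<epsilon> * sin \<theta> * (s - s0))"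
  have \<eta>: "\<eta>0 s = \<eta> s" if "s \<in> J" for s
    using \<epsilon>(2)[OF that] by (simp add: \<eta>_def)
  have \<eta>_deriv: "(\<eta> has_real_derivative \<epsilon> * sin \<theta>) (at s)" for s
    unfolding \<eta>_def by (auto intro!: derivative_eq_intros)
  have \<epsilon>sin: "\<epsilon> * sin \<theta> \<noteq> 0" using \<epsilon>(1) sin by auto
  \<comment> \<open>The constant is fitted at \<open>s0\<close>, the start of the open-closed
    argument.\<close>
  define b where "b = \<nu> s0 - \<epsilon> * V (\<eta> s0)"
  let ?v = "\<lambda>s. \<epsilon> * V (\<eta> s) + b"
  have v_deriv: "(?v has_real_derivative cos \<theta> / \<omega> (\<eta> s)) (at s)" if "\<eta> s \<in> I" for s
  proof -
    have "(?v has_real_derivative \<epsilon> * ((cot \<theta> / \<omega> (\<eta> s)) * (\<epsilon> * sin \<theta>)) + 0) (at s)"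
      by (intro DERIV_add DERIV_cmult DERIV_chain2[OF V[OF that] \<eta>_deriv] DERIV_const)
    \<comment> \<open>The sign in front of \<open>V\<close> and the sign of \<eta>' are the same
      \<epsilon>, and \<epsilon> times \<epsilon> is 1; hence v increases at the rate required of a
      lift.\<close>
    also have "\<epsilon> * ((cot \<theta> / \<omega> (\<eta> s)) * (\<epsilon> * sin \<theta>)) + 0 = cos \<theta> / \<omega> (\<eta> s)"
      using \<epsilon>(1) sin by (auto simp: cot_def)
    finally show ?thesis .
  qed
  have \<eta>I: "\<eta> s \<in> I" if "s \<in> J" for s
    using rep(1)[OF that] \<eta>[OF that] by simp
  have "\<alpha> s = \<Psi> (\<eta> s) (?v s)" if "s \<in> J" for s
  proof (rule eq_on_connected[of J s0 \<alpha> "\<lambda>s. \<Psi> (\<eta> s) (?v s)"])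
    show "connected J" using J(2) by (simp add: is_interval_connected_1)
    show "continuous_on J \<alpha>"
      using lox(1) by (simp add: loxodrome_def unit_speed_def smooth_curve_def)
    show "continuous_on J (\<lambda>s. \<Psi> (\<eta> s) (?v s))"
      using \<eta>I \<eta>_deriv v_deriv
      by (intro continuous_on_\<Psi>) (auto intro!: continuous_at_imp_continuous_on DERIV_isCont)
    show "\<alpha> s0 = \<Psi> (\<eta> s0) (?v s0)"
      using rep(2)[OF s0] \<eta>[OF s0] by (simp add: b_def)
    fix s assume s: "s \<in> J" "\<alpha> s = \<Psi> (\<eta> s) (?v s)"
    from constant_angle_local_lift[OF J(1) ca less_imp_neq[OF sin, symmetric] s(1) \<eta>I[OF s(1)] s(2)]
    obtain \<delta> \<sigma> w where \<delta>: "\<delta> > 0" and w: "w s = ?v s" and lift':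
      "\<forall>r. \<bar>r - s\<bar> < \<delta> \<longrightarrow> r \<in> J \<and>
        \<eta> s + \<sigma> * sin \<theta> * (r - s) \<in> I \<and> \<alpha> r = \<Psi> (\<eta> s + \<sigma> * sin \<theta> * (r - s)) (w r) \<and>
        (w has_real_derivative cos \<theta> / \<omega> (\<eta> s + \<sigma> * sin \<theta> * (r - s))) (at r)"
      by blast
    have lift: "r \<in> J" "\<eta> s + \<sigma> * sin \<theta> * (r - s) \<in> I" "\<alpha> r = \<Psi> (\<eta> s + \<sigma> * sin \<theta> * (r - s)) (w r)"
      "(w has_real_derivative cos \<theta> / \<omega> (\<eta> s + \<sigma> * sin \<theta> * (r - s))) (at r)" if "\<bar>r - s\<bar> < \<delta>" for r
      using lift' that by blast+
    \<comment> \<open>The local lift comes with its own sign \<sigma>; uniqueness of u forces its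
      first coordinate to follow the global \<eta>.\<close>
    have eq: "\<eta> s + \<sigma> * sin \<theta> * (r - s) = \<eta> r" if "\<bar>r - s\<bar> < \<delta>" for r
      using unique[OF lift(1-3)[OF that]] \<eta>[OF lift(1)[OF that]] by simp
    have "w r = ?v r" if r: "\<bar>r - s\<bar> < \<delta>" for r
    proof -
      \<comment> \<open>Over the same first coordinate both second coordinates satisfy the same
        differential equation, and they start from the same value at \<open>s\<close>.\<close>
      have "((\<lambda>r. w r - ?v r) has_real_derivative 0) (at x within {s - \<delta><..<s + \<delta>})"
        if "x \<in> {s - \<delta><..<s + \<delta>}" for x
      proof -
        have x: "\<bar>x - s\<bar> < \<delta>" using that by auto
        have "((\<lambda>r. w r - ?v r) has_real_derivative cos \<theta> / \<omega> (\<eta> x) - cos \<theta> / \<omega> (\<eta> x)) (at x)"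
          using DERIV_diff[OF lift(4)[OF x] v_deriv[OF \<eta>I[OF lift(1)[OF x]]]] unfolding eq[OF x] .
        then show ?thesis by (simp add: has_field_derivative_at_within)
      qed
      then have "\<exists>c. \<forall>x\<in>{s - \<delta><..<s + \<delta>}. w x - ?v x = c"
        by (intro has_field_derivative_zero_constant) auto
      then obtain c where "\<And>x. x \<in> {s - \<delta><..<s + \<delta>} \<Longrightarrow> w x - ?v x = c" by blast
      from this[of r] this[of s] show ?thesis using r \<delta> w by (auto simp: abs_less_iff)
    qed
    then have "\<alpha> r = \<Psi> (\<eta> r) (?v r)" if "\<bar>r - s\<bar> < \<delta>" for r
      using lift(3)[OF that] eq[OF that] that by simp
    then show "\<exists>\<delta>>0. \<forall>r. \<bar>r - s\<bar> < \<delta> \<longrightarrow> \<alpha> r = \<Psi> (\<eta> r) (?v r)"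
      using \<delta> by blast
  qed (use s0 that in auto)
  moreover have "smooth_on J \<eta>"
    unfolding \<eta>_def by (rule smooth_on_affine)
  moreover have "deriv \<eta> s \<noteq> 0" for s
    using DERIV_imp_deriv[OF \<eta>_deriv] \<epsilon>sin by simp
  moreover have "inj_on \<eta> J"
    using \<epsilon>sin by (auto simp: \<eta>_def inj_on_def)
  moreover have "\<eta> ` J \<subseteq> I"
    using \<eta>I by blast
  ultimately show ?thesis
    using \<epsilon>(1) by blast
qed

end

section \<open>The angular function\<close>

text \<open>
  The real logarithm satisfies \<open>ln x = ln \<bar>x\<bar>\<close>, and \<open>R \<omega>' + sqrt (- a)\<close> is negative where \<open>R \<omega>' < 0\<close>.
\<close>

lemma DERIV_ln_nonzero:
  fixes z :: real
  assumes "z \<noteq> 0"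
  shows "(ln has_real_derivative 1 / z) (at z)"
proof (cases "z > 0")
  case True
  then show ?thesis by (rule DERIV_ln_divide)
next
  case False
  then have z: "- z > 0" using assms by simp
  have "((\<lambda>x. ln (- x)) has_real_derivative 1 / (- z) * (- 1)) (at z)"
    by (rule DERIV_chain2[where f = ln and g = uminus, OF DERIV_ln_divide[OF z]]) (auto intro!: derivative_eq_intros)
  then show ?thesis by (simp add: ln_minus)
qed

text \<open>In each case the first integral lets \<omega>' be eliminated from the derivative. For a
  = 0, \<omega>''/\<omega>'^2 collapses to 1/\<omega>; for a < 0, the logarithmic derivative of its
  argument is a multiple of 1/\<omega>; for a > 0, the square root in the derivative of arcsin
  becomes sqrt a/\<omega>.\<close>

lemma
  fixes \<omega> \<omega>' :: "real \<Rightarrow> real"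
  assumes R: "R \<noteq> 0" and pos: "\<omega> u > 0" and a: "(\<omega> u)\<^sup>2 - R\<^sup>2 * (\<omega>' u)\<^sup>2 = a"
    and d1: "(\<omega> has_real_derivative \<omega>' u) (at u)" and d2: "(\<omega>' has_real_derivative \<omega> u / R\<^sup>2) (at u)"
  shows angular_function_zero: "a = 0 \<Longrightarrow> ((\<lambda>u. - (k / \<omega>' u)) has_real_derivative k / \<omega> u) (at u)"
    and angular_function_neg: "a < 0 \<Longrightarrow>
      ((\<lambda>u. - (R * k / sqrt (- a)) * ln ((R * \<omega>' u + sqrt (- a)) / \<omega> u)) has_real_derivative k / \<omega> u) (at u)"
    and angular_function_pos: "a > 0 \<Longrightarrow>
      ((\<lambda>u. (R * k / sqrt a) * arcsin (R * \<omega>' u / \<omega> u)) has_real_derivative k / \<omega> u) (at u)"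
proof -
  show "((\<lambda>u. - (k / \<omega>' u)) has_real_derivative k / \<omega> u) (at u)" if "a = 0"
  proof -
    have eq: "R\<^sup>2 * (\<omega>' u)\<^sup>2 = (\<omega> u)\<^sup>2" using a that by simp
    then have nz: "\<omega>' u \<noteq> 0" using pos by auto
    have "((\<lambda>u. - (k / \<omega>' u)) has_real_derivative k * (\<omega> u / R\<^sup>2) / (\<omega>' u)\<^sup>2) (at u)"
      using nz by (auto intro!: derivative_eq_intros d2 simp: power2_eq_square)
    also have "k * (\<omega> u / R\<^sup>2) / (\<omega>' u)\<^sup>2 = k * \<omega> u / (R\<^sup>2 * (\<omega>' u)\<^sup>2)" by simp
    also have "\<dots> = k / \<omega> u" unfolding eq using pos by (simp add: power2_eq_square)
    finally show ?thesis .
  qed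
  show "((\<lambda>u. - (R * k / sqrt (- a)) * ln ((R * \<omega>' u + sqrt (- a)) / \<omega> u)) has_real_derivative k / \<omega> u) (at u)"
    if "a < 0"
  proof -
    define c where "c = sqrt (- a)"
    have c: "c > 0" "c\<^sup>2 = - a" using that by (simp_all add: c_def)
    define z where "z = R * \<omega>' u + c"
    have sq: "(\<omega> u)\<^sup>2 = (R * \<omega>' u)\<^sup>2 - c\<^sup>2" using a c(2) by (simp add: power_mult_distrib)
    \<comment> \<open>This factorization of the first integral shows that the numerator
      \<open>z\<close> cannot vanish, whatever its sign, and later lets \<open>z\<close>
      cancel.\<close>
    then have prod: "(\<omega> u)\<^sup>2 = z * (z - 2 * c)"
      by (simp add: z_def power2_eq_square algebra_simps)
    then have "z \<noteq> 0" using pos by auto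
    have "((\<lambda>u. (R * \<omega>' u + c) / \<omega> u) has_real_derivative
        (R * (\<omega> u / R\<^sup>2) * \<omega> u - z * \<omega>' u) / (\<omega> u * \<omega> u)) (at u)"
      using pos by (auto intro!: derivative_eq_intros d1 d2 simp: z_def)
    also have "(R * (\<omega> u / R\<^sup>2) * \<omega> u - z * \<omega>' u) / (\<omega> u * \<omega> u) = - (c * z) / (R * (\<omega> u)\<^sup>2)"
    proof -
      have "R * (\<omega> u / R\<^sup>2) * \<omega> u - z * \<omega>' u = ((\<omega> u)\<^sup>2 - z * (R * \<omega>' u)) / R"
        using R by (simp add: field_simps power2_eq_square)
      also have "\<dots> = - (c * z) / R"
        unfolding prod by (simp add: z_def algebra_simps)
      finally show ?thesis by (simp add: power2_eq_square)
    qed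
    finally have dz: "((\<lambda>u. (R * \<omega>' u + c) / \<omega> u) has_real_derivative - (c * z) / (R * (\<omega> u)\<^sup>2)) (at u)" .
    have "((\<lambda>u. - (R * k / c) * ln ((R * \<omega>' u + c) / \<omega> u)) has_real_derivative
        - (R * k / c) * (1 / (z / \<omega> u) * (- (c * z) / (R * (\<omega> u)\<^sup>2)))) (at u)"
      using \<open>z \<noteq> 0\<close> pos
      by (intro DERIV_cmult DERIV_chain2[OF DERIV_ln_nonzero dz, unfolded z_def[symmetric]]) simp
    also have "- (R * k / c) * (1 / (z / \<omega> u) * (- (c * z) / (R * (\<omega> u)\<^sup>2))) = k / \<omega> u"
      using R c(1) \<open>z \<noteq> 0\<close> pos by (simp add: field_simps power2_eq_square)
    finally show ?thesis by (simp add: c_def)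
  qed
  show "((\<lambda>u. (R * k / sqrt a) * arcsin (R * \<omega>' u / \<omega> u)) has_real_derivative k / \<omega> u) (at u)" if "a > 0"
  proof -
    define x where "x = R * \<omega>' u / \<omega> u"
    \<comment> \<open>The first integral divided by \<open>\<omega>\<^sup>2\<close>. It keeps the
      argument of arcsin strictly between -1 and 1, where arcsin is differentiable.\<close>
    have x: "1 - x\<^sup>2 = a / (\<omega> u)\<^sup>2"
      using pos unfolding a[symmetric] by (simp add: x_def power_divide power_mult_distrib diff_divide_distrib)
    then have "x\<^sup>2 < 1" using that pos by (metis diff_gt_0_iff_gt divide_pos_pos zero_less_power)
    then have x1: "- 1 < x" "x < 1" using abs_square_less_1[of x] by auto
    have rt: "sqrt (1 - x\<^sup>2) = sqrt a / \<omega> u"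
      using pos by (simp add: x real_sqrt_divide)
    have "((\<lambda>u. R * \<omega>' u / \<omega> u) has_real_derivative
        (R * (\<omega> u / R\<^sup>2) * \<omega> u - R * \<omega>' u * \<omega>' u) / (\<omega> u * \<omega> u)) (at u)"
      using pos by (auto intro!: derivative_eq_intros d1 d2)
    also have "(R * (\<omega> u / R\<^sup>2) * \<omega> u - R * \<omega>' u * \<omega>' u) / (\<omega> u * \<omega> u) = a / (R * (\<omega> u)\<^sup>2)"
    proof -
      have "R * (\<omega> u / R\<^sup>2) * \<omega> u - R * \<omega>' u * \<omega>' u = a / R"
        unfolding a[symmetric] using R by (simp add: field_simps power2_eq_square)
      then show ?thesis by (simp add: power2_eq_square)
    qed
    finally have dx: "((\<lambda>u. R * \<omega>' u / \<omega> u) has_real_derivative a / (R * (\<omega> u)\<^sup>2)) (at u)" .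
    have "((\<lambda>u. (R * k / sqrt a) * arcsin (R * \<omega>' u / \<omega> u)) has_real_derivative
        (R * k / sqrt a) * (inverse (sqrt (1 - x\<^sup>2)) * (a / (R * (\<omega> u)\<^sup>2)))) (at u)"
      using x1 by (intro DERIV_cmult DERIV_chain2[OF DERIV_arcsin dx, unfolded x_def[symmetric]])
    also have "(R * k / sqrt a) * (inverse (sqrt (1 - x\<^sup>2)) * (a / (R * (\<omega> u)\<^sup>2))) = k / \<omega> u"
    proof -
      have "a = sqrt a * sqrt a" using that by simp
      then show ?thesis unfolding rt
        using R that pos by (simp add: field_simps power2_eq_square)
    qed
    finally show ?thesis .
  qed
qed

theorem proposition6p2:
  fixes A :: "('a::{t2_space, second_countable_topology}, real^3) chart set"
    and g :: "('a, real^3) metric"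
    and X :: "'a \<Rightarrow> ('a, real^3) tvec"
    and \<phi> :: "real \<Rightarrow> 'a \<Rightarrow> 'a"
    and Q :: "('q::{t2_space, second_countable_topology}, real^2) chart set"
    and gq :: "('q, real^2) metric"
    and \<pi> :: "'a \<Rightarrow> 'q"
    and B :: "('m::{t2_space, second_countable_topology}, real^2) chart set"
    and f :: "'m \<Rightarrow> 'a"
    and act :: "('a \<Rightarrow> 'a) \<Rightarrow> 'm \<Rightarrow> 'm"
    and I J :: "real set"
    and \<gamma>q :: "real \<Rightarrow> 'q" and \<gamma> :: "real \<Rightarrow> 'a" and \<gamma>M :: "real \<Rightarrow> 'm"
    and \<alpha> :: "real \<Rightarrow> 'm"
    and \<omega> :: "real \<Rightarrow> real"
    and \<psi> :: "real \<Rightarrow> real \<Rightarrow> 'a"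
    and \<Psi> :: "real \<Rightarrow> real \<Rightarrow> 'm"
    and R a \<theta>\<^sub>0 :: real
  assumes "smooth_structure A" and "riemannian_metric A g"
    and "killing_field A g X" and "isometry_flow A g X \<phi>"
    and "riemannian_orbit_space A g (range \<phi>) Q gq \<pi>"
    and "invariant_surface A \<phi> B f act"
    and "R \<noteq> 0" and "constant_gauss_curvature B (pullback_metric B A g f) (- 1 / R\<^sup>2)"
    and "open_interval I" and "unit_speed Q gq I \<gamma>q"
    and "smooth_curve A I \<gamma>" and "\<And>u. u \<in> I \<Longrightarrow> \<gamma> u \<in> regular_part (range \<phi>) \<and> \<pi> (\<gamma> u) = \<gamma>q u"
    and "\<And>u. u \<in> I \<Longrightarrow> g (\<gamma> u) (velocity A \<gamma> u) (X (\<gamma> u)) = 0"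
    and \<psi>_def: "\<And>u v. \<psi> u v = \<phi> v (\<gamma> u)"
    and "\<And>u. u \<in> I \<Longrightarrow> f (\<gamma>M u) = \<gamma> u"
    and \<Psi>_def: "\<And>u v. \<Psi> u v = act (\<phi> v) (\<gamma>M u)"
    and "local_parametrization B {x. x $ 1 \<in> I} (\<lambda>x. \<Psi> (x $ 1) (x $ 2))"
    and \<omega>_def: "\<And>u. \<omega> u = tangent_norm g (\<gamma> u) (X (\<gamma> u))"
    and "\<And>u. u \<in> I \<Longrightarrow> (\<omega> u)\<^sup>2 - R\<^sup>2 * (deriv \<omega> u)\<^sup>2 = a"
    and "loxodrome A g X B f J \<alpha> \<theta>\<^sub>0" and "\<theta>\<^sub>0 \<noteq> 0"
    and "\<alpha> ` J \<subseteq> {\<Psi> u v | u v. u \<in> I}"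
  shows "\<exists>\<epsilon> b v h. \<epsilon> \<in> {1, - 1} \<and>
    (smooth_on J h \<and> (\<forall>s\<in>J. deriv h s \<noteq> 0) \<and> inj_on h J \<and> h ` J \<subseteq> I) \<and>
    (\<forall>s\<in>J. \<alpha> s = \<Psi> (h s) (v (h s)) \<and> f (\<alpha> s) = \<psi> (h s) (v (h s))) \<and>
    (a = 0 \<longrightarrow> (\<forall>u\<in>I. v u = - \<epsilon> * (cot \<theta>\<^sub>0 / deriv \<omega> u) + b)) \<and>
    (a < 0 \<longrightarrow> (\<forall>u\<in>I. v u =
       - \<epsilon> * (R * cot \<theta>\<^sub>0 / sqrt (- a)) * ln ((R * deriv \<omega> u + sqrt (- a)) / \<omega> u) + b)) \<and>
    (a > 0 \<longrightarrow> (\<forall>u\<in>I. v u =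
       \<epsilon> * (R * cot \<theta>\<^sub>0 / sqrt a) * arcsin (R * deriv \<omega> u / \<omega> u) + b))"
proof -
  interpret adapted_surface A g X \<phi> Q gq \<pi> B f act I \<gamma>q \<gamma> \<gamma>M \<omega> \<Psi>
    by (rule adapted_surface.intro) (use assms in \<open>simp_all only:\<close>)
  \<comment> \<open>The minus signs for a = 0 and a < 0 are built into the primitive. All three
    cases then have derivative + cot \<theta>/\<omega>, and a single \<epsilon> produces both the
    upper and the lower signs of the formulas.\<close>
  define V where "V = (\<lambda>u. if a = 0 then - (cot \<theta>\<^sub>0 / deriv \<omega> u)
    else if a < 0 then - (R * cot \<theta>\<^sub>0 / sqrt (- a)) * ln ((R * deriv \<omega> u + sqrt (- a)) / \<omega> u)
    else (R * cot \<theta>\<^sub>0 / sqrt a) * arcsin (R * deriv \<omega> u / \<omega> u))"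
  have V: "(V has_real_derivative cot \<theta>\<^sub>0 / \<omega> u) (at u)" if u: "u \<in> I" for u
  proof -
    note angular = angular_function_zero angular_function_neg angular_function_pos
    note V_deriv = angular[where \<omega>' = "deriv \<omega>", OF assms(7) \<omega>_pos[OF u] assms(19)[OF u] \<omega>_ode[OF assms(7,8) u]]
    consider "a = 0" | "a < 0" | "a > 0" by linarith
    then show ?thesis
      using V_deriv[of "cot \<theta>\<^sub>0"] by cases (simp_all add: V_def)
  qed
  from loxodrome_graph[OF assms(7,8,20-22) V]
  obtain \<epsilon> b \<eta> where \<epsilon>: "\<epsilon> \<in> {1, - 1}"
    and \<eta>: "smooth_on J \<eta> \<and> (\<forall>s\<in>J. deriv \<eta> s \<noteq> 0) \<and> inj_on \<eta> J \<and> \<eta> ` J \<subseteq> I"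
    and \<alpha>: "\<forall>s\<in>J. \<alpha> s = \<Psi> (\<eta> s) (\<epsilon> * V (\<eta> s) + b)"
    by blast
  have f\<alpha>: "f (\<alpha> s) = \<psi> (\<eta> s) (\<epsilon> * V (\<eta> s) + b)" if "s \<in> J" for s
  proof -
    have "\<eta> s \<in> I" using \<eta> that by blast
    then show ?thesis using \<alpha> that f_\<Psi> by (simp add: \<psi>_def)
  qed
  show ?thesis
    by (intro exI[of _ \<epsilon>] exI[of _ b] exI[of _ "\<lambda>u. \<epsilon> * V u + b"] exI[of _ \<eta>] conjI)
      (use \<epsilon> \<eta> \<alpha> f\<alpha> in \<open>simp_all add: V_def\<close>)
qed

end
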